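(* Consider the equality constrained retrospective approximation algorithm described in the context. Assume: (i) $\chi\subset\mathbb{R}^n$ is an open convex set containing the sequence of iterates generated by any run of the algorithm; $f$ is continuously differentiable and bounded below over $\chi$ with $\nabla f$ Lipschitz continuous over $\chi$; $c$ is continuously differentiable, $J=\nabla c^T$ is Lipschitz continuous over $\chi$, and $J(x)$ has full row rank for all $x\in\chi$; (ii) (component gradients) for the finite-sum problem there are $\omega_1,\omega_2\ge0$ with $\|\nabla F(x,\xi)\|^2\le\omega_1^2\|\nabla f(x)\|^2+\omega_2^2$ for all $x\in\chi$, $\xi\in\mathcal{S}$; for the expectation problem there are $\tilde\omega_1,\tilde\omega_2\ge0$ with $\mathbb{E}[\|\nabla f(x)-\nabla F(x,\xi)\|^2\mid x]\le\tilde\omega_1^2\|\nabla f(x)\|^2+\tilde\omega_2^2$ for all $x\in\chi$; (iii) there is $\kappa_g\ge0$ with $\|\nabla f(x_{k,N_k})\|\le\kappa_g$ for all $k\ge0$; (iv) (sublinear inner solver) the inner loop exhibits sublinear convergence, i.e., for all $k\ge0$ an $\epsilon$-accurate solution to the subsampled problem, $\|T_{S_k}(x_{k,N_k},\lambda_{k,N_k})\|\le\epsilon$, is achieved in $N_k=\mathcal{O}(\epsilon^{-2})$ iterations; (v) the batch size sequence $\{|S_k|\}$ is chosen to satisfy the sampling condition stated in the context. 1. (Finite-sum problem.) If for all $k\ge0$ the termination parameters are $0\le\gamma_k\le\gamma<1$ and $\epsilon_k=\omega\|\nabla f(x_{k,0})-g_{S_k}(x_{k,0})\|+\hat\omega\beta^k$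 with $\omega,\hat\omega>0$, and the sampling condition parameters are such that $\gamma+\theta(\omega+\hat\theta+\gamma)<\beta$, then one achieves an $\epsilon>0$ accurate solution in $\mathcal{O}(\epsilon^{-2})$ inner iterations and $\mathcal{O}(|\mathcal{S}|\epsilon^{-2})$ gradient evaluations. 2. (Expectation problem.) Assume in addition that there are $\kappa_G\ge0$ and $\kappa_\sigma>0$ such that $\mathbb{E}[G_S^2]\le\kappa_G^2/|S|$ for any set $S$ of i.i.d. samples from $\mathcal{P}$, and $\operatorname{Var}(\nabla F(x_{k,0},\xi)\mid\mathcal{F}_k)\ge\kappa_G^2\kappa_\sigma^2$ for all $k\ge0$. If for all $k\ge0$ the termination parameters are $0\le\gamma_k\le\tilde\gamma<1$ and $\epsilon_k=\tilde\omega\sqrt{\operatorname{Var}(\nabla F(x_{k,0},\xi)\mid\mathcal{F}_k)/|S_k|}$ with $\tilde\omega>0$, and the sampling condition parameters are such that $\tilde\gamma+\tilde\theta\left(\tilde\omega+\frac{\epsilon_G+\kappa_g}{\kappa_\sigma}+\tilde\gamma\right)<\tilde\beta$ and $\tilde a=\sqrt{\frac{\tilde\omega_1^2\kappa_g^2+\tilde\omega_2^2}{|S_0|}}$, where $|S_0|$ is the initial batch size, then one achieves an $\epsilon>0$ accurate solution in expectation in $\mathcal{O}(\epsilon^{-2})$ inner iterations and $\mathcal{O}(\epsilon^{-4})$ gradient evaluations.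
   Context: Problem: $\min_{x\in\mathbb{R}^n}f(x)$ subject to $c(x)=0$, with $f:\mathbb{R}^n\to\mathbb{R}$, $c:\mathbb{R}^n\to\mathbb{R}^m$. Finite-sum problem: $f(x)=\frac{1}{|\mathcal{S}|}\sum_{\xi\in\mathcal{S}}F(x,\xi)$ for a finite dataset $\mathcal{S}$. Expectation problem: $f(x)=\mathbb{E}[F(x,\xi)]$ with $\xi\sim\mathcal{P}$. $\|\cdot\|$ is the Euclidean norm; $\nabla F$ is the gradient in $x$. For a sample set $S$ ($S\subseteq\mathcal{S}$ in the finite-sum case, i.i.d. draws from $\mathcal{P}$ in the expectation case): $F_S(x)=\frac1{|S|}\sum_{\xi\in S}F(x,\xi)$, $g_S(x)=\frac1{|S|}\sum_{\xi\in S}\nabla F(x,\xi)$. $J(x)=\nabla c(x)^T$. KKT residuals: $T(x,\lambda)=\begin{bmatrix}\nabla f(x)+\nabla c(x)\lambda\\ c(x)\end{bmatrix}$, $T_S(x,\lambda)=\begin{bmatrix}g_S(x)+\nabla c(x)\lambda\\ c(x)\end{bmatrix}$. Algorithm: inputs are batch sizes $|S_k|$, parameters $\gamma_k\in[0,1)$, $\epsilon_k\ge0$, initial $x_{0,0}$ and $\lambda_{-1,0}$ (with $N_{-1}=0$). At outer iteration $k=0,1,\dots$: obtain a sample set $S_k$ (in the expectation case, i.i.d. samples independent of $\mathcal{F}_k$, the batch size $|S_k|$ being chosen at the beginning of the outer iteration). Set the initial dual variable $\lambda_{k,0}$ either to $\lambda_{k-1,N_{k-1}}$ or to $-(J(x_{k,0})J(x_{k,0})^T)^{-1}J(x_{k,0})g_{S_k}(x_{k,0})$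 (or to any vector with $\|T_{S_k}(x_{k,0},\lambda_{k,0})\|\le\|T_{S_k}(x_{k,0},\lambda_{k-1,N_{k-1}})\|$). Starting from $(x_{k,0},\lambda_{k,0})$ a deterministic solver applied to the subsampled problem $\min F_{S_k}(x)$ s.t. $c(x)=0$ generates $(x_{k,j},\lambda_{k,j})$, $j=0,1,\dots$; the inner loop stops at the first index $j=N_k$ with $\|T_{S_k}(x_{k,j},\lambda_{k,j})\|\le\gamma_k\|T_{S_k}(x_{k,0},\lambda_{k,0})\|+\epsilon_k$, and $x_{k+1,0}=x_{k,N_k}$. Sampling condition, required at every outer iteration $k\ge0$. Finite-sum problem: with constants $\theta,\hat\theta,a\ge0$ and $\beta\in(0,1)$, $\|\nabla f(x_{k,0})-g_{S_k}(x_{k,0})\|^2\le\theta^2\|T(x_{k,0},\lambda_{k-1,N_{k-1}})\|^2+a^2\beta^{2k}$ and $\|\nabla f(x_{k,N_k})-g_{S_k}(x_{k,N_k})\|^2\le\hat\theta^2\left(\theta^2\|T(x_{k,0},\lambda_{k-1,N_{k-1}})\|^2+a^2\beta^{2k}\right)$. Expectation problem: with constants $\tilde\theta,\tilde a\ge0$ and $\tilde\beta\in(0,1)$, $\mathbb{E}[\|\nabla f(x_{k,0})-g_{S_k}(x_{k,0})\|^2\mid\mathcal{F}_k]\le\tilde\theta^2\|T(x_{k,0},\lambda_{k-1,N_{k-1}})\|^2+\tilde a^2\tilde\beta^{2k}$. An $\epsilon$-accurate solution means $\|T(x_{k,N_k},\lambda_{k,N_k})\|\le\epsilon$ (finite-sum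 problem), respectively $\mathbb{E}[\|T(x_{k,N_k},\lambda_{k,N_k})\|]\le\epsilon$ (in expectation, expectation problem). With $K_\epsilon$ the number of outer iterations to reach it, the number of inner iterations is the total $\sum_{k=0}^{K_\epsilon}N_k$, and the number of gradient evaluations is $\sum_{k=0}^{K_\epsilon}|S_k|N_k$ (one subsampled gradient computation per inner iteration). $\mathcal{F}_k$ is the $\sigma$-algebra of the initial conditions and $S_0,\dots,S_{k-1}$; $\mathbb{E}[\cdot]=\mathbb{E}[\cdot\mid\mathcal{F}_0]$. $\operatorname{Var}(\cdot\mid\mathcal{F}_k)$ is the conditional variance with respect to $\xi\sim\mathcal{P}$ (expected squared norm of the deviation from the mean). $G_S=\max_{x\in\chi}\frac{\|\nabla f(x)-g_S(x)\|}{\epsilon_G+\|\nabla f(x)\|}$ with a fixed $\epsilon_G>0$.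
   Formalization: In part 2, batch sizes are also assumed not excessive: |S_k| is at most a constant times any b≥1 with Var(∇F(x_{k,0},ξ)|F_k)/b ≤ ã²β̃^{2k} (arbitrarily large batches break the bounds), and κ_G>0 replaces κ_G≥0 (the zero-variance case gives ε_k=0 and can fail). *)

theory Defs
  imports "HOL-Probability.Probability"
begin

definition grad :: "(real^'n \<Rightarrow> real) \<Rightarrow> real^'n \<Rightarrow> real^'n" where
  "grad h y = (THE D. GDERIV h y :> D)"

definition finite_sum_obj :: "'s set \<Rightarrow> (real^'n \<Rightarrow> 's \<Rightarrow> real) \<Rightarrow> real^'n \<Rightarrow> real" where
  "finite_sum_obj D F y = (\<Sum>s\<in>D. F y s) / real (card D)"

definition expectation_obj :: "'s measure \<Rightarrow> (real^'n \<Rightarrow> 's \<Rightarrow> real) \<Rightarrow> real^'n \<Rightarrow> real" where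
  "expectation_obj P F y = (\<integral>s. F y s \<partial>P)"

text \<open>The subsampled gradient. A sample set is a family \<open>(s i)\<close> indexed by a finite set \<open>I\<close>:
  a subset \<open>S\<close> of a dataset is the family \<open>id\<close> on \<open>S\<close>, while \<open>b\<close> i.i.d. draws (which may
  coincide) are a family on \<open>{..<b}\<close>.\<close>

definition sample_grad ::
    "(real^'n \<Rightarrow> 's \<Rightarrow> real) \<Rightarrow> 'i set \<Rightarrow> ('i \<Rightarrow> 's) \<Rightarrow> real^'n \<Rightarrow> real^'n" where
  "sample_grad F I s y = (\<Sum>i\<in>I. grad (\<lambda>z. F z (s i)) y) /\<^sub>R real (card I)"

text \<open>\<open>jacobian c (at y)\<close> is the \<open>m \<times> n\<close> matrix \<open>J(y)\<close>, so the gradient matrix of \<open>c\<close> is its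
  transpose. The norm of a pair is the Euclidean norm of the stacked vector.
  \<open>kkt_res (grad f) c\<close> is the KKT residual of the true problem, and
  \<open>kkt_res (sample_grad F I s) c\<close> that of the subsampled one.\<close>

definition kkt_res ::
    "(real^'n \<Rightarrow> real^'n) \<Rightarrow> (real^'n \<Rightarrow> real^'m) \<Rightarrow> real^'n \<Rightarrow> real^'m
      \<Rightarrow> (real^'n) \<times> (real^'m)" where
  "kkt_res g c y l = (g y + transpose (jacobian c (at y)) *v l, c y)"

definition ls_multiplier ::
    "(real^'n \<Rightarrow> real^'n) \<Rightarrow> (real^'n \<Rightarrow> real^'m) \<Rightarrow> real^'n \<Rightarrow> real^'m" where
  "ls_multiplier g c y =
     (let J = jacobian c (at y) in - (matrix_inv (J ** transpose J) *v (J *v g y)))"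

definition regular_problem ::
    "(real^'n) set \<Rightarrow> (real^'n \<Rightarrow> real) \<Rightarrow> (real^'n \<Rightarrow> real^'m) \<Rightarrow> bool" where
  "regular_problem X f c \<longleftrightarrow>
     open X \<and> convex X \<and>
     (\<forall>y\<in>X. f differentiable (at y)) \<and> continuous_on X (grad f) \<and>
     bdd_below (f ` X) \<and> (\<exists>L. L-lipschitz_on X (grad f)) \<and>
     (\<forall>y\<in>X. c differentiable (at y)) \<and> continuous_on X (\<lambda>y. jacobian c (at y)) \<and>
     (\<exists>L. L-lipschitz_on X (\<lambda>y. jacobian c (at y))) \<and>
     (\<forall>y\<in>X. rank (jacobian c (at y)) = CARD('m))"

text \<open>The dual variable inherited from the previous outer iteration; \<open>l0\<close> is the input
  \<open>\<lambda>\<^bsub>-1,0\<^esub>\<close>.\<close>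

definition prev_dual :: "real^'m \<Rightarrow> (nat \<Rightarrow> nat \<Rightarrow> real^'m) \<Rightarrow> (nat \<Rightarrow> nat) \<Rightarrow> nat \<Rightarrow> real^'m" where
  "prev_dual l0 lam N k = (case k of 0 \<Rightarrow> l0 | Suc i \<Rightarrow> lam i (N i))"

definition inner_stop ::
    "(real^'n \<Rightarrow> real^'m) \<Rightarrow> (nat \<Rightarrow> real^'n \<Rightarrow> real^'n) \<Rightarrow> (nat \<Rightarrow> real) \<Rightarrow> (nat \<Rightarrow> real)
      \<Rightarrow> (nat \<Rightarrow> nat \<Rightarrow> real^'n) \<Rightarrow> (nat \<Rightarrow> nat \<Rightarrow> real^'m) \<Rightarrow> nat \<Rightarrow> nat \<Rightarrow> bool" where
  "inner_stop c g gam eps x lam k j \<longleftrightarrow>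
     norm (kkt_res (g k) c (x k j) (lam k j))
       \<le> gam k * norm (kkt_res (g k) c (x k 0) (lam k 0)) + eps k"

text \<open>One run of the algorithm, where \<open>g k\<close> is the gradient of the \<open>k\<close>-th subsampled objective.
  The solver is not restricted: its iterates \<open>x k j\<close>, \<open>lam k j\<close> (for all \<open>j\<close>, also beyond the
  stopping index \<open>N k\<close>) are arbitrary sequences.\<close>

definition ra_run ::
    "(real^'n \<Rightarrow> real^'m) \<Rightarrow> (nat \<Rightarrow> real^'n \<Rightarrow> real^'n) \<Rightarrow> (nat \<Rightarrow> real) \<Rightarrow> (nat \<Rightarrow> real)
      \<Rightarrow> real^'m \<Rightarrow> (nat \<Rightarrow> nat \<Rightarrow> real^'n) \<Rightarrow> (nat \<Rightarrow> nat \<Rightarrow> real^'m) \<Rightarrow> (nat \<Rightarrow> nat) \<Rightarrow> bool" where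
  "ra_run c g gam eps l0 x lam N \<longleftrightarrow>
     (\<forall>k. 0 \<le> gam k \<and> gam k < 1 \<and> 0 \<le> eps k \<and>
        (lam k 0 = prev_dual l0 lam N k \<or>
         lam k 0 = ls_multiplier (g k) c (x k 0) \<or>
         norm (kkt_res (g k) c (x k 0) (lam k 0))
           \<le> norm (kkt_res (g k) c (x k 0) (prev_dual l0 lam N k))) \<and>
        inner_stop c g gam eps x lam k (N k) \<and>
        (\<forall>j<N k. \<not> inner_stop c g gam eps x lam k j) \<and>
        x (Suc k) 0 = x k (N k))"

text \<open>Every subsampled problem is solved to accuracy \<open>e\<close> within \<open>C / e\<^sup>2\<close> inner iterations, for
  all \<open>e\<close> up to \<open>e0\<close>; the constants of this \<open>O(e\<^sup>-\<^sup>2)\<close> do not depend on \<open>k\<close>.\<close>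

definition sublinear_inner ::
    "real \<Rightarrow> real \<Rightarrow> (real^'n \<Rightarrow> real^'m) \<Rightarrow> (nat \<Rightarrow> real^'n \<Rightarrow> real^'n)
      \<Rightarrow> (nat \<Rightarrow> nat \<Rightarrow> real^'n) \<Rightarrow> (nat \<Rightarrow> nat \<Rightarrow> real^'m) \<Rightarrow> bool" where
  "sublinear_inner C e0 c g x lam \<longleftrightarrow>
     (\<forall>k. \<forall>e. 0 < e \<and> e \<le> e0 \<longrightarrow>
        (\<exists>j. real j \<le> C / e\<^sup>2 \<and> norm (kkt_res (g k) c (x k j) (lam k j)) \<le> e))"

text \<open>The variance of the component gradient at \<open>y\<close> over \<open>s \<sim> P\<close>. The conditional variance given
  \<open>\<F>\<^sub>k\<close> is \<open>grad_var P F\<close> evaluated at the \<open>\<F>\<^sub>k\<close>-measurable point \<open>x k 0\<close>.\<close>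

definition grad_var :: "'s measure \<Rightarrow> (real^'n \<Rightarrow> 's \<Rightarrow> real) \<Rightarrow> real^'n \<Rightarrow> real" where
  "grad_var P F y =
     (\<integral>s. (norm (grad (\<lambda>z. F z s) y - (\<integral>t. grad (\<lambda>z. F z t) y \<partial>P)))\<^sup>2 \<partial>P)"

text \<open>The relative deviation \<open>G\<^sub>S\<close> for \<open>b\<close> samples \<open>s 0, \<dots>, s (b - 1)\<close>. It is taken in
  the extended nonnegative reals, so that the supremum is meaningful without a boundedness
  assumption.\<close>

definition grad_dev ::
    "(real^'n) set \<Rightarrow> (real^'n \<Rightarrow> real) \<Rightarrow> (real^'n \<Rightarrow> 's \<Rightarrow> real) \<Rightarrow> real \<Rightarrow> nat \<Rightarrow> (nat \<Rightarrow> 's) \<Rightarrow> ennreal" where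
  "grad_dev X f F eG b s =
     (SUP y\<in>X. ennreal (norm (grad f y - sample_grad F {..<b} s y) / (eG + norm (grad f y))))"

text \<open>The \<open>\<sigma>\<close>-algebra \<open>\<F>\<^sub>k\<close> of \<open>S\<^sub>0, \<dots>, S\<^sub>k\<^sub>-\<^sub>1\<close>. The sample set \<open>S\<^sub>j\<close> consists of the first
  \<open>n w j\<close> entries of the stream of draws \<open>xi w j 0, xi w j 1, \<dots>\<close>; only these entries and
  their number are observed. The initial conditions are deterministic, so \<open>\<F>\<^sub>0\<close> is trivial.\<close>

definition history ::
    "'w measure \<Rightarrow> 's measure \<Rightarrow> ('w \<Rightarrow> nat \<Rightarrow> nat) \<Rightarrow> ('w \<Rightarrow> nat \<Rightarrow> nat \<Rightarrow> 's) \<Rightarrow> nat \<Rightarrow> 'w measure" where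
  "history M P n xi k =
     sigma (space M) {{w \<in> space M. i < n w j \<and> xi w j i \<in> A} | i j A. j < k \<and> A \<in> sets P}"

locale ra_finite_sum =
  fixes X :: "(real^'n) set"
    and c :: "real^'n \<Rightarrow> real^'m"
    and D :: "'s set"
    and F :: "real^'n \<Rightarrow> 's \<Rightarrow> real"
    and S :: "nat \<Rightarrow> 's set"
    and gam eps :: "nat \<Rightarrow> real"
    and l0 :: "real^'m"
    and x :: "nat \<Rightarrow> nat \<Rightarrow> real^'n"
    and lam :: "nat \<Rightarrow> nat \<Rightarrow> real^'m"
    and N :: "nat \<Rightarrow> nat"
    and \<theta> \<theta>' a \<beta> :: real
  assumes dataset: "finite D" "D \<noteq> {}"
    and component_diff: "\<And>s y. s \<in> D \<Longrightarrow> y \<in> X \<Longrightarrow> (\<lambda>z. F z s) differentiable (at y)"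
    and sample_sets: "\<And>k. S k \<subseteq> D" "\<And>k. S k \<noteq> {}"
    and run: "ra_run c (\<lambda>k. sample_grad F (S k) id) gam eps l0 x lam N"
    and regular: "regular_problem X (finite_sum_obj D F) c"
    and iterates_in: "\<And>k j. j \<le> N k \<Longrightarrow> x k j \<in> X"
    and component_grads: "\<exists>\<omega>1\<ge>0. \<exists>\<omega>2\<ge>0. \<forall>y\<in>X. \<forall>s\<in>D.
        (norm (grad (\<lambda>z. F z s) y))\<^sup>2 \<le> \<omega>1\<^sup>2 * (norm (grad (finite_sum_obj D F) y))\<^sup>2 + \<omega>2\<^sup>2"
    and grad_bound: "\<exists>\<kappa>\<ge>0. \<forall>k. norm (grad (finite_sum_obj D F) (x k (N k))) \<le> \<kappa>"
    and inner_rate: "\<exists>C>0. \<exists>e0>0. sublinear_inner C e0 c (\<lambda>k. sample_grad F (S k) id) x lam"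
    and sampling_params: "0 \<le> \<theta>" "0 \<le> \<theta>'" "0 \<le> a" "0 < \<beta>" "\<beta> < 1"
    and sampling_start: "\<And>k.
        (norm (grad (finite_sum_obj D F) (x k 0) - sample_grad F (S k) id (x k 0)))\<^sup>2
          \<le> \<theta>\<^sup>2 * (norm (kkt_res (grad (finite_sum_obj D F)) c (x k 0) (prev_dual l0 lam N k)))\<^sup>2
             + a\<^sup>2 * \<beta> ^ (2 * k)"
    and sampling_end: "\<And>k.
        (norm (grad (finite_sum_obj D F) (x k (N k)) - sample_grad F (S k) id (x k (N k))))\<^sup>2
          \<le> \<theta>'\<^sup>2 * (\<theta>\<^sup>2 * (norm (kkt_res (grad (finite_sum_obj D F)) c (x k 0) (prev_dual l0 lam N k)))\<^sup>2
             + a\<^sup>2 * \<beta> ^ (2 * k))"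

text \<open>In the expectation problem \<open>w\<close> ranges over the outcomes of \<open>M\<close>, and \<open>n w k\<close> is the
  batch size \<open>|S\<^sub>k|\<close>. The assumption \<open>batch_economy\<close> expresses that batch sizes are chosen to
  meet the sampling condition and are not excessive: up to a constant factor, \<open>n w k\<close> is at most
  every \<open>b\<close> for which the variance of an average over \<open>b\<close> samples is below the additive
  tolerance \<open>a\<^sup>2 \<beta>\<^bsup>2k\<^esup>\<close>. When the component gradients are unbiased and their
  variance is bounded away from zero, this covers both the smallest batch size meeting the
  condition and geometrically growing batch sizes \<open>n w 0 / \<beta>\<^bsup>2k\<^esup>\<close>. The complexity bounds are false for batch
  sizes that meet the condition but are arbitrarily large. The constants \<open>C\<close> and \<open>e0\<close> in
  \<open>inner_rate\<close> are uniform over all runs.\<close>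

locale ra_expectation =
  fixes X :: "(real^'n) set"
    and c :: "real^'n \<Rightarrow> real^'m"
    and P :: "'s measure"
    and F :: "real^'n \<Rightarrow> 's \<Rightarrow> real"
    and M :: "'w measure"
    and n :: "'w \<Rightarrow> nat \<Rightarrow> nat"
    and xi :: "'w \<Rightarrow> nat \<Rightarrow> nat \<Rightarrow> 's"
    and gam eps :: "'w \<Rightarrow> nat \<Rightarrow> real"
    and n0 :: nat
    and x0 :: "real^'n"
    and l0 :: "real^'m"
    and x :: "'w \<Rightarrow> nat \<Rightarrow> nat \<Rightarrow> real^'n"
    and lam :: "'w \<Rightarrow> nat \<Rightarrow> nat \<Rightarrow> real^'m"
    and N :: "'w \<Rightarrow> nat \<Rightarrow> nat"
    and \<theta> a \<beta> \<omega>1 \<omega>2 \<kappa>g :: real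
  assumes prob_P: "prob_space P" and prob_M: "prob_space M"
    and component_integrable: "\<And>y. integrable P (F y)"
    and component_diff: "\<And>s y. s \<in> space P \<Longrightarrow> y \<in> X \<Longrightarrow> (\<lambda>z. F z s) differentiable (at y)"
    and component_grad_measurable:
      "(\<lambda>(y, s). grad (\<lambda>z. F z s) y) \<in> borel_measurable (restrict_space borel X \<Otimes>\<^sub>M P)"
    and draws_distr: "\<And>k i. (\<lambda>w. xi w k i) \<in> measurable M P"
      "\<And>k i. distr M P (\<lambda>w. xi w k i) = P"
    and draws_indep: "\<And>k. prob_space.indep_vars M (\<lambda>i. P) (\<lambda>i w. xi w k i) UNIV"
    and draws_indep_history: "\<And>k. prob_space.indep_set M (sets (history M P n xi k))
        (sets (vimage_algebra (space M) (\<lambda>w. xi w k) (Pi\<^sub>M UNIV (\<lambda>i. P))))"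
    and initial: "\<And>w. w \<in> space M \<Longrightarrow> x w 0 0 = x0" "\<And>w. w \<in> space M \<Longrightarrow> n w 0 = n0"
    and batch_pos: "\<And>w k. w \<in> space M \<Longrightarrow> 1 \<le> n w k"
    and adapted: "\<And>k. (\<lambda>w. n w k) \<in> measurable (history M P n xi k) (count_space UNIV)"
      "\<And>k. (\<lambda>w. x w k 0) \<in> borel_measurable (history M P n xi k)"
      "\<And>k. (\<lambda>w. prev_dual l0 (lam w) (N w) k) \<in> borel_measurable (history M P n xi k)"
    and run: "\<And>w. w \<in> space M \<Longrightarrow>
        ra_run c (\<lambda>k. sample_grad F {..<n w k} (xi w k)) (gam w) (eps w) l0 (x w) (lam w) (N w)"
    and regular: "regular_problem X (expectation_obj P F) c"
    and iterates_in: "\<And>w k j. w \<in> space M \<Longrightarrow> j \<le> N w k \<Longrightarrow> x w k j \<in> X"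
    and component_grads_params: "0 \<le> \<omega>1" "0 \<le> \<omega>2"
    and component_grads: "\<And>y. y \<in> X \<Longrightarrow>
        integrable P (\<lambda>s. (norm (grad (expectation_obj P F) y - grad (\<lambda>z. F z s) y))\<^sup>2)"
      "\<And>y. y \<in> X \<Longrightarrow>
        (\<integral>s. (norm (grad (expectation_obj P F) y - grad (\<lambda>z. F z s) y))\<^sup>2 \<partial>P)
          \<le> \<omega>1\<^sup>2 * (norm (grad (expectation_obj P F) y))\<^sup>2 + \<omega>2\<^sup>2"
    and grad_bound: "0 \<le> \<kappa>g"
      "\<And>w k. w \<in> space M \<Longrightarrow> norm (grad (expectation_obj P F) (x w k (N w k))) \<le> \<kappa>g"
    and inner_rate: "\<exists>C>0. \<exists>e0>0. \<forall>w\<in>space M.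
        sublinear_inner C e0 c (\<lambda>k. sample_grad F {..<n w k} (xi w k)) (x w) (lam w)"
    and sampling_params: "0 \<le> \<theta>" "0 \<le> a" "0 < \<beta>" "\<beta> < 1"
    and sampling: "\<And>k. AE w in M.
        real_cond_exp M (history M P n xi k)
          (\<lambda>w. (norm (grad (expectation_obj P F) (x w k 0)
                       - sample_grad F {..<n w k} (xi w k) (x w k 0)))\<^sup>2) w
        \<le> \<theta>\<^sup>2 * (norm (kkt_res (grad (expectation_obj P F)) c (x w k 0)
                         (prev_dual l0 (lam w) (N w) k)))\<^sup>2
           + a\<^sup>2 * \<beta> ^ (2 * k)"
    and batch_economy: "\<exists>\<kappa>. \<forall>w\<in>space M. \<forall>k. \<forall>b\<ge>1.
        grad_var P F (x w k 0) / real b \<le> a\<^sup>2 * \<beta> ^ (2 * k) \<longrightarrow> real (n w k) \<le> \<kappa> * real b"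

definition accurate ::
    "(real^'n \<Rightarrow> real^'m) \<Rightarrow> (real^'n \<Rightarrow> real) \<Rightarrow> (nat \<Rightarrow> nat \<Rightarrow> real^'n) \<Rightarrow> (nat \<Rightarrow> nat \<Rightarrow> real^'m)
      \<Rightarrow> (nat \<Rightarrow> nat) \<Rightarrow> real \<Rightarrow> nat \<Rightarrow> bool" where
  "accurate c f x lam N e k \<longleftrightarrow> norm (kkt_res (grad f) c (x k (N k)) (lam k (N k))) \<le> e"

definition accurate_in_expectation ::
    "'w measure \<Rightarrow> (real^'n \<Rightarrow> real^'m) \<Rightarrow> (real^'n \<Rightarrow> real) \<Rightarrow> ('w \<Rightarrow> nat \<Rightarrow> nat \<Rightarrow> real^'n)
      \<Rightarrow> ('w \<Rightarrow> nat \<Rightarrow> nat \<Rightarrow> real^'m) \<Rightarrow> ('w \<Rightarrow> nat \<Rightarrow> nat) \<Rightarrow> real \<Rightarrow> nat \<Rightarrow> bool" where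
  "accurate_in_expectation M c f x lam N e k \<longleftrightarrow>
     integrable M (\<lambda>w. norm (kkt_res (grad f) c (x w k (N w k)) (lam w k (N w k)))) \<and>
     (\<integral>w. norm (kkt_res (grad f) c (x w k (N w k)) (lam w k (N w k))) \<partial>M) \<le> e"

end

theory Submission
  imports Defs
begin

text \<open>
  Let \<open>R\<^sub>k\<close> be the true KKT residual at the start of outer iteration \<open>k\<close>, taken with the inherited dual
  variable. The stopping test and two triangle inequalities give
  \<open>R\<^sub>k\<^sub>+\<^sub>1 \<le> \<gamma> (R\<^sub>k + \<delta>\<^sub>k) + \<epsilon>\<^sub>k + \<delta>'\<^sub>k\<close>, where \<open>\<delta>\<^sub>k\<close> and \<open>\<delta>'\<^sub>k\<close> are the gradient errors at the two
  ends of the iteration. All three error terms are \<open>O(\<theta> R\<^sub>k + a \<beta>\<^sup>k)\<close> (for the expectation problem after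
  averaging, since \<open>Var/|S\<^sub>k|\<close> is at most the conditional mean squared error at the start), so \<open>R\<^sub>k\<close>
  decays like \<open>\<beta>\<^sup>k\<close>. The stopping tolerance, on the other hand, is at least of order \<open>\<beta>\<^sup>k\<close>, so
  \<open>N\<^sub>k = O(\<beta>\<^bsup>-2k\<^esup>)\<close>, and similarly \<open>|S\<^sub>k| = O(\<beta>\<^bsup>-2k\<^esup>)\<close> for the expectation problem. The costs grow
  geometrically, hence their sum is dominated by the last iteration, where \<open>\<beta>\<^sup>k\<close> is of order \<open>\<epsilon>\<close>.
\<close>

subsection \<open>Geometrically growing costs\<close>

text \<open>The gap between \<open>\<rho>\<close> and \<open>\<beta>\<close> absorbs the
  perturbation: \<open>\<rho> * B + b \<le> \<beta> * B\<close>, so the bound reproduces itself from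
  one index to the next.\<close>

lemma linear_recursion_bound:
  fixes r :: "nat \<Rightarrow> real"
  assumes rec: "\<And>k. r (Suc k) \<le> \<rho> * r k + b * \<beta> ^ k"
    and \<rho>: "0 \<le> \<rho>" "\<rho> < \<beta>" and b: "b \<le> (\<beta> - \<rho>) * B" and r0: "r 0 \<le> B"
  shows "r k \<le> B * \<beta> ^ k"
proof (induction k)
  case (Suc k)
  have "r (Suc k) \<le> \<rho> * (B * \<beta> ^ k) + b * \<beta> ^ k"
    using rec[of k] mult_left_mono[OF Suc \<rho>(1)] by linarith
  also have "\<dots> \<le> \<rho> * (B * \<beta> ^ k) + ((\<beta> - \<rho>) * B) * \<beta> ^ k"
    using b \<rho> by (intro add_left_mono mult_right_mono) auto
  also have "\<dots> = B * \<beta> ^ Suc k" by (simp add: algebra_simps)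
  finally show ?case .
qed (simp add: r0)

text \<open>The factor \<open>1 / (1 - p)\<close> is the fixed point of
  \<open>u = p * u + 1\<close>, which is exactly what adding one more term requires.\<close>

lemma sum_inverse_power_le:
  fixes p :: real
  assumes "0 < p" "p < 1"
  shows "(\<Sum>k\<le>K. 1 / p ^ k) \<le> 1 / (1 - p) * (1 / p ^ K)"
proof (induction K)
  case (Suc K)
  have "(\<Sum>k\<le>Suc K. 1 / p ^ k) \<le> 1 / (1 - p) * (1 / p ^ K) + 1 / p ^ Suc K"
    using Suc by simp
  also have "\<dots> = 1 / (1 - p) * (1 / p ^ Suc K)"
    using assms by (simp add: field_simps)
  finally show ?case .
qed (use assms in simp)

text \<open>All \<open>k\<close> before the first index \<open>K\<close> with accuracy \<open>e\<close> satisfy \<open>e < B \<beta>\<^sup>k\<close>, so a geometrically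
  growing cost is dominated by its last term, which is of order \<open>e\<^bsup>-q\<^esup>\<close>.\<close>

lemma geometric_cost_until_accurate:
  fixes r :: "nat \<Rightarrow> real"
  assumes \<beta>: "0 < \<beta>" "\<beta> < 1" and r: "\<And>k. r k \<le> B * \<beta> ^ k" and B: "1 \<le> B" and q: "1 \<le> q"
    and e: "0 < e" "e \<le> 1"
  shows "\<exists>k. r (Suc k) \<le> e"
    and "(\<Sum>k\<le>(LEAST k. r (Suc k) \<le> e). 1 / \<beta> ^ (q * k)) \<le> B ^ q / (1 - \<beta> ^ q) / e ^ q"
proof -
  define K where "K = (LEAST k. r (Suc k) \<le> e)"
  have "(\<lambda>k. B * \<beta> ^ Suc k) \<longlonglongrightarrow> B * 0"
    by (intro tendsto_mult tendsto_const LIMSEQ_Suc LIMSEQ_realpow_zero) (use \<beta> in auto)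
  then have "\<forall>\<^sub>F k in sequentially. B * \<beta> ^ Suc k < e"
    by (rule order_tendstoD) (use e in simp)
  then show ex: "\<exists>k. r (Suc k) \<le> e"
    unfolding eventually_sequentially using r by (meson less_imp_le order.trans order_refl)
  \<comment> \<open>The shift matters: the accuracy after iteration \<open>k\<close> is
    \<open>r (Suc k)\<close>, so minimality of \<open>K = Suc i\<close> says that \<open>r K\<close>
    itself still exceeds \<open>e\<close>. At \<open>K = 0\<close> there is no earlier index, and
    \<open>e \<le> 1 \<le> B\<close> takes over.\<close>
  have eK: "e \<le> B * \<beta> ^ K"
  proof (cases K)
    case 0
    then show ?thesis using e B by simp
  next
    case (Suc i)
    then have "\<not> r (Suc i) \<le> e"
      unfolding K_def using not_less_Least lessI by metis
    with r[of K] show ?thesis using Suc by simp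
  qed
  have p: "0 < \<beta> ^ q" "\<beta> ^ q < 1"
    using \<beta> q by (auto simp: power_less_one_iff)
  have "(\<Sum>k\<le>K. 1 / \<beta> ^ (q * k)) \<le> 1 / (1 - \<beta> ^ q) * (1 / (\<beta> ^ q) ^ K)"
    using sum_inverse_power_le[OF p, of K] by (simp add: power_mult)
  also have "\<dots> \<le> 1 / (1 - \<beta> ^ q) * (B ^ q / e ^ q)"
  proof (intro mult_left_mono)
    have "e ^ q \<le> (B * \<beta> ^ K) ^ q"
      using eK e by (intro power_mono) auto
    also have "\<dots> = B ^ q * (\<beta> ^ q) ^ K"
      by (simp add: power_mult_distrib mult.commute flip: power_mult)
    finally show "1 / (\<beta> ^ q) ^ K \<le> B ^ q / e ^ q"
      using e \<beta> by (simp add: field_simps)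
  qed (use p in simp)
  finally show "(\<Sum>k\<le>(LEAST k. r (Suc k) \<le> e). 1 / \<beta> ^ (q * k)) \<le> B ^ q / (1 - \<beta> ^ q) / e ^ q"
    by (simp add: K_def field_simps)
qed

text \<open>Only the nonnegative cross term is added. This turns the squared sampling condition into
  a perfect square, so that roots can be taken.\<close>

lemma sampling_tolerance_le_square:
  fixes \<theta> r a \<beta> :: real
  assumes "0 \<le> \<theta>" "0 \<le> r" "0 \<le> a" "0 \<le> \<beta>"
  shows "\<theta>\<^sup>2 * r\<^sup>2 + a\<^sup>2 * \<beta> ^ (2 * k) \<le> (\<theta> * r + a * \<beta> ^ k)\<^sup>2"
proof -
  have "0 \<le> 2 * (\<theta> * r) * (a * \<beta> ^ k)"
    using assms by simp
  then show ?thesis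
    by (simp add: power2_sum power_mult_distrib power_mult[symmetric] mult.commute[of k])
qed

subsection \<open>Runs of the algorithm\<close>

text \<open>Exchanging the gradient changes only the first block of the residual, and by an amount
  independent of the multiplier.\<close>

lemma norm_kkt_res_le:
  "norm (kkt_res g c y l) \<le> norm (kkt_res h c y l) + norm (g y - h y)"
proof -
  have "kkt_res g c y l = kkt_res h c y l + (g y - h y, 0)"
    by (simp add: kkt_res_def)
  then show ?thesis
    using norm_triangle_ineq[of "kkt_res h c y l" "(g y - h y, 0)"] by (simp add: norm_Pair)
qed

text \<open>A kernel vector \<open>v\<close> satisfies \<open>J *v (transpose J *v v) = 0\<close>;
  pairing with \<open>v\<close> makes \<open>transpose J *v v\<close> vanish, and full row rank
  makes \<open>transpose J\<close> injective.\<close>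

lemma invertible_mult_transpose_full_rank:
  fixes J :: "real^'n^'m"
  assumes "rank J = CARD('m)"
  shows "invertible (J ** transpose J)"
proof -
  have inj: "inj ((*v) (transpose J))"
    using assms by (simp add: rank_transpose flip: full_rank_injective)
  have "v = 0" if "(J ** transpose J) *v v = 0" for v
  proof -
    have "J *v (transpose J *v v) = 0"
      using that by (simp only: matrix_vector_mul_assoc)
    then have "(transpose J *v v) \<bullet> (transpose J *v v) = 0"
      by (metis dot_lmul_matrix inner_zero_right inner_commute transpose_matrix_vector)
    then have "transpose J *v v = transpose J *v 0" by simp
    with inj show "v = 0" by (metis injD)
  qed
  then show ?thesis
    by (simp add: invertible_left_inverse matrix_left_invertible_ker)
qed

text \<open>The least-squares multiplier makes the first block orthogonal to the range of
  \<open>transpose J\<close>. Any other multiplier adds a vector of that range, which by Pythagoras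
  can only lengthen the block.\<close>

lemma norm_kkt_res_ls_multiplier_le:
  fixes g :: "real^'n \<Rightarrow> real^'n" and c :: "real^'n \<Rightarrow> real^'m"
  assumes "rank (jacobian c (at y)) = CARD('m)"
  shows "norm (kkt_res g c y (ls_multiplier g c y)) \<le> norm (kkt_res g c y l)"
proof -
  define J where "J = jacobian c (at y)"
  define l' where "l' = ls_multiplier g c y"
  \<comment> \<open>\<open>matrix_inv\<close> is given by a choice operator, so its inverse law is
    extracted from the existence of some inverse.\<close>
  have inv: "(J ** transpose J) ** matrix_inv (J ** transpose J) = mat 1"
    using someI_ex[OF invertible_mult_transpose_full_rank[OF assms, unfolded invertible_def]]
    unfolding matrix_inv_def J_def by blast
  have "J *v (g y + transpose J *v l')
      = J *v g y - ((J ** transpose J) ** matrix_inv (J ** transpose J)) *v (J *v g y)"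
    by (simp add: l'_def ls_multiplier_def Let_def matrix_vector_right_distrib
        matrix_vector_mult_diff_distrib matrix_vector_mul_assoc matrix_mul_assoc J_def
        vec.neg flip: matrix_vector_mul_assoc)
  then have ker: "J *v (g y + transpose J *v l') = 0"
    by (simp add: inv)
  have orth: "orthogonal (g y + transpose J *v l') (transpose J *v (l - l'))"
    unfolding orthogonal_def
    by (metis ker dot_lmul_matrix inner_zero_right inner_commute transpose_matrix_vector)
  have split: "g y + transpose J *v l = (g y + transpose J *v l') + transpose J *v (l - l')"
    by (simp add: matrix_vector_mult_diff_distrib)
  have "(norm (g y + transpose J *v l'))\<^sup>2 \<le> (norm (g y + transpose J *v l))\<^sup>2"
    unfolding split norm_add_Pythagorean[OF orth] by simp
  then show ?thesis
    unfolding kkt_res_def norm_Pair J_def[symmetric] l'_def[symmetric]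
    by (intro real_sqrt_le_mono add_right_mono)
qed

lemma prev_dual_Suc [simp]: "prev_dual l0 lam N (Suc k) = lam k (N k)"
  by (simp add: prev_dual_def)

lemma ra_runD:
  assumes "ra_run c g gam eps l0 x lam N"
  shows "0 \<le> gam k" "0 \<le> eps k" "x (Suc k) 0 = x k (N k)" "inner_stop c g gam eps x lam k (N k)"
    "\<And>j. j < N k \<Longrightarrow> \<not> inner_stop c g gam eps x lam k j"
  using assms by (auto simp: ra_run_def)

text \<open>All three admissible initial duals are covered: the inherited one trivially, the
  least-squares one by its minimality, and the last by its defining inequality.\<close>

lemma ra_run_warm_start:
  fixes c :: "real^'n \<Rightarrow> real^'m"
  assumes "ra_run c g gam eps l0 x lam N" "rank (jacobian c (at (x k 0))) = CARD('m)"
  shows "norm (kkt_res (g k) c (x k 0) (lam k 0))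
    \<le> norm (kkt_res (g k) c (x k 0) (prev_dual l0 lam N k))"
  using assms(1) norm_kkt_res_ls_multiplier_le[OF assms(2)] unfolding ra_run_def
  by (metis order_refl)

text \<open>Here \<open>h\<close> stands for the true gradient. It is exchanged for
  \<open>g k\<close> at the end point, where the stopping test applies, and restored at the start
  point after the warm start.\<close>

lemma ra_run_residual_step:
  fixes c :: "real^'n \<Rightarrow> real^'m"
  assumes run: "ra_run c g gam eps l0 x lam N"
    and rank: "rank (jacobian c (at (x k 0))) = CARD('m)" and \<gamma>: "gam k \<le> \<gamma>"
  shows "norm (kkt_res h c (x (Suc k) 0) (prev_dual l0 lam N (Suc k)))
    \<le> \<gamma> * (norm (kkt_res h c (x k 0) (prev_dual l0 lam N k)) + norm (h (x k 0) - g k (x k 0)))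
       + eps k + norm (h (x k (N k)) - g k (x k (N k)))"
proof -
  have "norm (kkt_res h c (x (Suc k) 0) (prev_dual l0 lam N (Suc k)))
      \<le> norm (kkt_res (g k) c (x k (N k)) (lam k (N k))) + norm (h (x k (N k)) - g k (x k (N k)))"
    using norm_kkt_res_le by (simp add: ra_runD[OF run])
  also have "norm (kkt_res (g k) c (x k (N k)) (lam k (N k)))
      \<le> gam k * norm (kkt_res (g k) c (x k 0) (lam k 0)) + eps k"
    using ra_runD(4)[OF run] by (simp add: inner_stop_def)
  also have "gam k * norm (kkt_res (g k) c (x k 0) (lam k 0))
      \<le> \<gamma> * (norm (kkt_res h c (x k 0) (prev_dual l0 lam N k)) + norm (h (x k 0) - g k (x k 0)))"
  proof (intro mult_mono)
    show "norm (kkt_res (g k) c (x k 0) (lam k 0))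
        \<le> norm (kkt_res h c (x k 0) (prev_dual l0 lam N k)) + norm (h (x k 0) - g k (x k 0))"
      using ra_run_warm_start[OF run rank]
        norm_kkt_res_le[of "g k" c "x k 0" "prev_dual l0 lam N k" h]
      by (simp add: norm_minus_commute)
  qed (use \<gamma> ra_runD(1)[OF run, of k] in auto)
  finally show ?thesis by simp
qed

text \<open>An iterate with residual at most \<open>t \<le> eps k\<close> already passes the
  stopping test, since the \<open>gam k\<close> term is nonnegative; \<open>N k\<close> is the first
  index that passes.\<close>

lemma ra_run_inner_iterations_le:
  assumes run: "ra_run c g gam eps l0 x lam N" and rate: "sublinear_inner C e0 c g x lam"
    and t: "0 < t" "t \<le> e0" "t \<le> eps k"
  shows "real (N k) \<le> C / t\<^sup>2"
proof -
  obtain j where j: "real j \<le> C / t\<^sup>2" "norm (kkt_res (g k) c (x k j) (lam k j)) \<le> t"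
    using rate t unfolding sublinear_inner_def by blast
  have "0 \<le> gam k * norm (kkt_res (g k) c (x k 0) (lam k 0))"
    using ra_runD(1)[OF run] by simp
  then have "inner_stop c g gam eps x lam k j"
    using j t unfolding inner_stop_def by linarith
  then have "N k \<le> j"
    using ra_runD(5)[OF run] by (metis not_less)
  then show ?thesis using j by linarith
qed

text \<open>The accuracy requested from the solver is \<open>min e0 t * \<beta> ^ k\<close>: the
  rate is available only up to \<open>e0\<close>, and \<open>\<beta> ^ k \<le> 1\<close> keeps the
  request in that range for every \<open>k\<close>.\<close>

lemma ra_run_inner_iterations_geometric:
  assumes run: "ra_run c g gam eps l0 x lam N" and rate: "sublinear_inner C e0 c g x lam"
    and "0 < C" "0 < e0" "0 < t" "0 < \<beta>" "\<beta> \<le> 1" "t * \<beta> ^ k \<le> eps k"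
  shows "real (N k) \<le> C / (min e0 t)\<^sup>2 / \<beta> ^ (2 * k)"
proof -
  have "min e0 t * \<beta> ^ k \<le> e0 * 1" "min e0 t * \<beta> ^ k \<le> t * \<beta> ^ k"
    using assms by (intro mult_mono; auto simp: power_le_one)+
  then have "min e0 t * \<beta> ^ k \<le> e0" "min e0 t * \<beta> ^ k \<le> eps k"
    using assms by linarith+
  then have "real (N k) \<le> C / (min e0 t * \<beta> ^ k)\<^sup>2"
    using assms by (intro ra_run_inner_iterations_le[OF run rate]) simp_all
  then show ?thesis
    by (simp add: power_mult_distrib power_mult[symmetric] mult.commute)
qed

subsection \<open>The finite-sum problem\<close>

context ra_finite_sum
begin

text \<open>The multiplier is the inherited one rather than \<open>lam k 0\<close>: the sampling
  condition is phrased with it, and it makes the start of one iteration coincide with the end of the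
  previous one.\<close>

abbreviation residual :: "nat \<Rightarrow> real" where
  "residual k \<equiv> norm (kkt_res (grad (finite_sum_obj D F)) c (x k 0) (prev_dual l0 lam N k))"

abbreviation sampling_error :: "nat \<Rightarrow> real" where
  "sampling_error k \<equiv>
     norm (grad (finite_sum_obj D F) (x k 0) - sample_grad F (S k) id (x k 0))"

lemma residual_Suc:
  "residual (Suc k) = norm (kkt_res (grad (finite_sum_obj D F)) c (x k (N k)) (lam k (N k)))"
  using ra_runD(3)[OF run] by simp

lemma sampling_error_le: "sampling_error k \<le> \<theta> * residual k + a * \<beta> ^ k"
proof (rule power2_le_imp_le)
  have "\<theta>\<^sup>2 * (residual k)\<^sup>2 + a\<^sup>2 * \<beta> ^ (2 * k) \<le> (\<theta> * residual k + a * \<beta> ^ k)\<^sup>2"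
    using sampling_params by (intro sampling_tolerance_le_square) simp_all
  then show "(sampling_error k)\<^sup>2 \<le> (\<theta> * residual k + a * \<beta> ^ k)\<^sup>2"
    using sampling_start[of k] by linarith
qed (use sampling_params in simp)

lemma sampling_error_end_le:
  "norm (grad (finite_sum_obj D F) (x k (N k)) - sample_grad F (S k) id (x k (N k)))
    \<le> \<theta>' * (\<theta> * residual k + a * \<beta> ^ k)"
proof (rule power2_le_imp_le)
  have "\<theta>\<^sup>2 * (residual k)\<^sup>2 + a\<^sup>2 * \<beta> ^ (2 * k) \<le> (\<theta> * residual k + a * \<beta> ^ k)\<^sup>2"
    using sampling_params by (intro sampling_tolerance_le_square) simp_all
  then have "\<theta>'\<^sup>2 * (\<theta>\<^sup>2 * (residual k)\<^sup>2 + a\<^sup>2 * \<beta> ^ (2 * k))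
      \<le> (\<theta>' * (\<theta> * residual k + a * \<beta> ^ k))\<^sup>2"
    by (simp add: power_mult_distrib mult_left_mono)
  then show "(norm (grad (finite_sum_obj D F) (x k (N k))
        - sample_grad F (S k) id (x k (N k))))\<^sup>2 \<le> (\<theta>' * (\<theta> * residual k + a * \<beta> ^ k))\<^sup>2"
    using sampling_end[of k] by linarith
qed (use sampling_params in simp)

lemma residual_geometric:
  assumes \<omega>: "0 < \<omega>" "0 < \<omega>'" and gam: "\<And>k. 0 \<le> gam k \<and> gam k \<le> \<gamma>"
    and eps: "\<And>k. eps k = \<omega> * sampling_error k + \<omega>' * \<beta> ^ k"
    and rate: "\<gamma> + \<theta> * (\<omega> + \<theta>' + \<gamma>) < \<beta>"
  obtains B where "1 \<le> B" "\<And>k. residual k \<le> B * \<beta> ^ k"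
proof -
  \<comment> \<open>\<open>\<rho>\<close> and \<open>b\<close> collect the coefficients of
    \<open>residual k\<close> and of \<open>\<beta> ^ k\<close> in the one-step estimate.
    \<open>B\<close> is the least number above 1 and above the initial residual for which the linear
    recursion closes.\<close>
  define \<rho> where "\<rho> = \<gamma> + \<theta> * (\<omega> + \<theta>' + \<gamma>)"
  define b where "b = a * (\<omega> + \<theta>' + \<gamma>) + \<omega>'"
  define B where "B = max 1 (max (residual 0) (b / (\<beta> - \<rho>)))"
  have \<gamma>: "0 \<le> \<gamma>" using gam[of 0] by linarith
  have \<rho>: "0 \<le> \<rho>" "\<rho> < \<beta>"
    using \<gamma> \<omega> sampling_params rate by (auto simp: \<rho>_def)
  have "residual (Suc k) \<le> \<rho> * residual k + b * \<beta> ^ k" for k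
  proof -
    have "rank (jacobian c (at (x k 0))) = CARD('m)"
      using regular iterates_in[of 0 k] by (auto simp: regular_problem_def)
    from ra_run_residual_step[where h = "grad (finite_sum_obj D F)" and \<gamma> = \<gamma>, OF run this]
    have "residual (Suc k)
        \<le> \<gamma> * (residual k + sampling_error k) + (\<omega> * sampling_error k + \<omega>' * \<beta> ^ k)
          + norm (grad (finite_sum_obj D F) (x k (N k)) - sample_grad F (S k) id (x k (N k)))"
      using gam[of k] by (simp add: eps)
    also have "\<dots> \<le> \<gamma> * (residual k + (\<theta> * residual k + a * \<beta> ^ k))
          + (\<omega> * (\<theta> * residual k + a * \<beta> ^ k) + \<omega>' * \<beta> ^ k)
          + \<theta>' * (\<theta> * residual k + a * \<beta> ^ k)"
      using sampling_error_le[of k] sampling_error_end_le[of k] \<omega> \<gamma>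
      by (intro add_mono mult_left_mono) auto
    also have "\<dots> = \<rho> * residual k + b * \<beta> ^ k"
      by (simp add: \<rho>_def b_def algebra_simps)
    finally show ?thesis .
  qed
  moreover have "b \<le> (\<beta> - \<rho>) * B"
  proof -
    have "b / (\<beta> - \<rho>) \<le> B" by (simp add: B_def)
    then show ?thesis using \<rho> by (simp add: field_simps)
  qed
  ultimately have "residual k \<le> B * \<beta> ^ k" for k
    using \<rho> by (intro linear_recursion_bound[where r = residual and \<rho> = \<rho> and b = b])
      (auto simp: B_def)
  then show ?thesis
    by (intro that[of B]) (auto simp: B_def)
qed

lemma complexity:
  assumes \<omega>: "0 < \<omega>" "0 < \<omega>'" and gam: "\<And>k. 0 \<le> gam k \<and> gam k \<le> \<gamma>"
    and eps: "\<And>k. eps k = \<omega> * sampling_error k + \<omega>' * \<beta> ^ k"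
    and rate: "\<gamma> + \<theta> * (\<omega> + \<theta>' + \<gamma>) < \<beta>"
  shows "\<exists>C>0. \<forall>\<^sub>F e in at_right 0.
    (\<exists>k. accurate c (finite_sum_obj D F) x lam N e k) \<and>
    (let K = (LEAST k. accurate c (finite_sum_obj D F) x lam N e k) in
       real (\<Sum>k\<le>K. N k) \<le> C / e\<^sup>2 \<and>
       real (\<Sum>k\<le>K. card (S k) * N k) \<le> C * (real (card D) / e\<^sup>2))"
proof -
  obtain B where B: "1 \<le> B" "\<And>k. residual k \<le> B * \<beta> ^ k"
    using residual_geometric[OF assms] by blast
  obtain C e0 where C: "0 < C" "0 < e0"
      "sublinear_inner C e0 c (\<lambda>k. sample_grad F (S k) id) x lam"
    using inner_rate by auto
  \<comment> \<open>The term \<open>\<omega>' * \<beta> ^ k\<close> alone bounds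
    \<open>eps k\<close> from below, so \<open>\<omega>'\<close> plays the role of \<open>t\<close>
    in the inner iteration count.\<close>
  define A where "A = C / (min e0 \<omega>')\<^sup>2"
  have A: "0 < A" using C \<omega> by (simp add: A_def)
  have N: "real (N k) \<le> A * (1 / \<beta> ^ (2 * k))" for k
    using ra_run_inner_iterations_geometric[OF run C(3) C(1,2), of \<omega>' \<beta> k] \<omega> sampling_params
    by (simp add: A_def eps)
  have card: "card (S k) \<le> card D" for k
    using dataset sample_sets by (intro card_mono)
  have acc: "accurate c (finite_sum_obj D F) x lam N e k \<longleftrightarrow> residual (Suc k) \<le> e" for e k
    unfolding accurate_def residual_Suc ..
  \<comment> \<open>This is the geometric cost constant for \<open>q = 2\<close>. It serves both
    counts, because every batch has at most \<open>card D\<close> elements.\<close>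
  define C' where "C' = A * (B ^ 2 / (1 - \<beta> ^ 2))"
  have "\<beta> ^ 2 < 1" using sampling_params by (simp add: power_less_one_iff)
  then have C': "0 < C'" using A B by (simp add: C'_def)
  show ?thesis
  proof (rule exI[of _ C'], rule conjI[OF C'], rule eventually_mono[OF eventually_at_right_real[of 0 1]])
    fix e :: real
    assume "e \<in> {0<..<1}"
    then have e: "0 < e" "e \<le> 1" by auto
    define K where "K = (LEAST k. residual (Suc k) \<le> e)"
    note cost = geometric_cost_until_accurate[OF sampling_params(4,5) B(2,1) _ e, of 2]
    have "real (\<Sum>k\<le>K. N k) \<le> (\<Sum>k\<le>K. A * (1 / \<beta> ^ (2 * k)))"
      by (simp only: of_nat_sum) (intro sum_mono N)
    also have "\<dots> \<le> A * (B ^ 2 / (1 - \<beta> ^ 2) / e ^ 2)"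
      using cost(2) A unfolding K_def sum_distrib_left[symmetric] by (intro mult_left_mono) auto
    finally have *: "real (\<Sum>k\<le>K. N k) \<le> C' / e\<^sup>2" by (simp add: C'_def)
    have "(\<Sum>k\<le>K. card (S k) * N k) \<le> card D * (\<Sum>k\<le>K. N k)"
      unfolding sum_distrib_left by (intro sum_mono mult_right_mono card) auto
    then have "real (\<Sum>k\<le>K. card (S k) * N k) \<le> real (card D) * real (\<Sum>k\<le>K. N k)"
      by (metis of_nat_le_iff of_nat_mult)
    also have "\<dots> \<le> real (card D) * (C' / e\<^sup>2)"
      using * by (intro mult_left_mono) auto
    finally have "real (\<Sum>k\<le>K. card (S k) * N k) \<le> C' * (real (card D) / e\<^sup>2)"
      by (simp add: mult.commute)
    with * cost(1) show "(\<exists>k. accurate c (finite_sum_obj D F) x lam N e k) \<and>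
        (let K = (LEAST k. accurate c (finite_sum_obj D F) x lam N e k) in
           real (\<Sum>k\<le>K. N k) \<le> C' / e\<^sup>2 \<and>
           real (\<Sum>k\<le>K. card (S k) * N k) \<le> C' * (real (card D) / e\<^sup>2))"
      unfolding acc Let_def K_def by simp
  qed simp
qed

end

subsection \<open>Errors of sample means\<close>

text \<open>Independence of a family means that its joint law is the product of the marginals; the
  joint map of all coordinates is the identity.\<close>

lemma indep_vars_PiM_components:
  assumes "prob_space M"
  shows "prob_space.indep_vars (Pi\<^sub>M UNIV (\<lambda>_. M)) (\<lambda>_. M) (\<lambda>i s. s i) (UNIV :: nat set)"
proof -
  interpret prob_space M by fact
  interpret product_prob_space "\<lambda>_. M" "UNIV :: nat set" ..
  show ?thesis
    by (subst P.indep_vars_iff_distr_eq_PiM) (auto simp: PiM_component restrict_UNIV)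
qed

context prob_space
begin

text \<open>The scalar product rule for independent variables is applied in each coordinate and
  summed over the basis.\<close>

lemma indep_var_inner:
  fixes X Y :: "'a \<Rightarrow> 'b::euclidean_space"
  assumes indep: "indep_var borel X borel Y" and int: "integrable M X" "integrable M Y"
  shows integrable_inner_indep: "integrable M (\<lambda>w. X w \<bullet> Y w)"
    and expectation_inner_indep: "expectation (\<lambda>w. X w \<bullet> Y w) = expectation X \<bullet> expectation Y"
proof -
  have ind: "indep_var borel (\<lambda>w. X w \<bullet> b) borel (\<lambda>w. Y w \<bullet> b)" for b
    using indep_var_compose[OF indep, of "\<lambda>v. v \<bullet> b" borel "\<lambda>v. v \<bullet> b" borel]
    by (simp add: o_def)
  have "integrable M (\<lambda>w. (X w \<bullet> b) * (Y w \<bullet> b))" for b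
    using int by (intro indep_var_integrable[OF ind]) auto
  moreover have "expectation (\<lambda>w. (X w \<bullet> b) * (Y w \<bullet> b)) = (expectation X \<bullet> b) * (expectation Y \<bullet> b)" for b
    using int by (subst indep_var_lebesgue_integral[OF ind]) auto
  moreover have "(\<lambda>w. X w \<bullet> Y w) = (\<lambda>w. \<Sum>b\<in>Basis. (X w \<bullet> b) * (Y w \<bullet> b))"
    by (rule ext) (rule euclidean_inner)
  ultimately show "integrable M (\<lambda>w. X w \<bullet> Y w)"
      "expectation (\<lambda>w. X w \<bullet> Y w) = expectation X \<bullet> expectation Y"
    by (simp, subst euclidean_inner[of "expectation X"], simp)
qed

text \<open>After centring, the square splits into a constant, a linear term of mean zero and a
  double sum in which only the \<open>m\<close> diagonal terms survive, giving
  \<open>m * V / m\<^sup>2\<close>. The centre \<open>v\<close> is arbitrary, so a squared bias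
  remains.\<close>

lemma
  fixes X :: "nat \<Rightarrow> 'a \<Rightarrow> 'b::euclidean_space"
  assumes indep: "indep_vars (\<lambda>_. borel) X UNIV"
    and int: "\<And>i. integrable M (X i)" and mean: "\<And>i. expectation (X i) = \<mu>"
    and sq: "\<And>i. integrable M (\<lambda>w. (norm (X i w - \<mu>))\<^sup>2)"
    and var: "\<And>i. expectation (\<lambda>w. (norm (X i w - \<mu>))\<^sup>2) = V"
    and m: "0 < m"
  shows integrable_sample_mean_error:
      "integrable M (\<lambda>w. (norm (v - (\<Sum>i<m. X i w) /\<^sub>R real m))\<^sup>2)"
    and expectation_sample_mean_error:
      "expectation (\<lambda>w. (norm (v - (\<Sum>i<m. X i w) /\<^sub>R real m))\<^sup>2)
        = V / real m + (norm (v - \<mu>))\<^sup>2"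
proof -
  define Z where "Z i w = X i w - \<mu>" for i w
  have Z_int: "integrable M (Z i)" for i
    unfolding Z_def using int by simp
  have Z_mean: "expectation (Z i) = 0" for i
    unfolding Z_def using int mean by (simp add: prob_space)
  have Z_indep: "indep_vars (\<lambda>_. borel) Z UNIV"
    unfolding Z_def using indep_vars_compose2[OF indep, of "\<lambda>_ v. v - \<mu>" "\<lambda>_. borel"] by simp
  have ZZ: "integrable M (\<lambda>w. Z i w \<bullet> Z j w) \<and>
      expectation (\<lambda>w. Z i w \<bullet> Z j w) = (if i = j then V else 0)" for i j
  proof (cases "i = j")
    case True
    then show ?thesis
      using sq[of i] var[of i] by (simp add: Z_def power2_norm_eq_inner)
  next
    case False
    \<comment> \<open>Pairwise independence is read off from the family by restricting it to two
      disjoint singleton index sets and projecting.\<close>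
    then have "indep_var (Pi\<^sub>M {i} (\<lambda>_. borel)) (\<lambda>w. restrict (\<lambda>i. Z i w) {i})
        (Pi\<^sub>M {j} (\<lambda>_. borel)) (\<lambda>w. restrict (\<lambda>i. Z i w) {j})"
      by (intro indep_var_restrict[OF Z_indep]) auto
    from indep_var_compose[OF this, of "\<lambda>s. s i" borel "\<lambda>s. s j" borel]
    have "indep_var borel (Z i) borel (Z j)"
      by (simp add: o_def)
    then show ?thesis
      using integrable_inner_indep expectation_inner_indep Z_int Z_mean False
      by (metis inner_zero_left)
  qed
  have eq: "(norm (v - (\<Sum>i<m. X i w) /\<^sub>R real m))\<^sup>2
      = (norm (v - \<mu>))\<^sup>2 - 2 / real m * ((v - \<mu>) \<bullet> (\<Sum>i<m. Z i w))
        + (\<Sum>i<m. \<Sum>j<m. Z i w \<bullet> Z j w) / (real m)\<^sup>2" for w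
  proof -
    have "v - (\<Sum>i<m. X i w) /\<^sub>R real m = (v - \<mu>) - (\<Sum>i<m. Z i w) /\<^sub>R real m"
      using m by (simp add: Z_def sum_subtractf scaleR_diff_right sum_constant_scaleR)
    moreover have "(\<Sum>i<m. \<Sum>j<m. Z i w \<bullet> Z j w) = (\<Sum>i<m. Z i w) \<bullet> (\<Sum>i<m. Z i w)"
      by (simp only: inner_sum_left inner_sum_right) (rule sum.swap)
    moreover have "(norm (p - t *\<^sub>R q))\<^sup>2 = (norm p)\<^sup>2 - 2 * t * (p \<bullet> q) + t\<^sup>2 * (q \<bullet> q)"
      for p q :: 'b and t
      unfolding power2_norm_eq_inner inner_diff_left inner_diff_right inner_scaleR_left
        inner_scaleR_right inner_commute[of q p] by (simp add: algebra_simps power2_eq_square)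
    ultimately show ?thesis
      by (simp only:) (simp add: divide_inverse power_inverse mult.commute)
  qed
  show "integrable M (\<lambda>w. (norm (v - (\<Sum>i<m. X i w) /\<^sub>R real m))\<^sup>2)"
    unfolding eq using ZZ Z_int
    by (intro Bochner_Integration.integrable_add Bochner_Integration.integrable_diff
        integrable_mult_right integrable_inner_right Bochner_Integration.integrable_sum
        integrable_divide) auto
  have "expectation (\<lambda>w. (norm (v - (\<Sum>i<m. X i w) /\<^sub>R real m))\<^sup>2)
      = (norm (v - \<mu>))\<^sup>2 + (\<Sum>i<m. \<Sum>j<m. (if i = j then V else 0)) / (real m)\<^sup>2"
    unfolding eq using ZZ Z_int Z_mean by (simp add: prob_space)
  then show "expectation (\<lambda>w. (norm (v - (\<Sum>i<m. X i w) /\<^sub>R real m))\<^sup>2)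
      = V / real m + (norm (v - \<mu>))\<^sup>2"
    using m by (simp add: power2_eq_square)
qed

end

text \<open>The coordinates of the infinite product are i.i.d. with law \<open>M\<close>, so the
  error formula for sample means applies to \<open>h\<close> evaluated along them.\<close>

lemma (in prob_space)
  fixes h :: "'a \<Rightarrow> 'b::euclidean_space"
  assumes int: "integrable M h" "integrable M (\<lambda>s. (norm (h s - expectation h))\<^sup>2)"
    and m: "0 < m"
  shows integrable_PiM_sample_mean_error:
      "integrable (Pi\<^sub>M UNIV (\<lambda>_. M)) (\<lambda>s. (norm (v - (\<Sum>i<m. h (s i)) /\<^sub>R real m))\<^sup>2)"
    and integral_PiM_sample_mean_error:
      "(\<integral>s. (norm (v - (\<Sum>i<m. h (s i)) /\<^sub>R real m))\<^sup>2 \<partial>(Pi\<^sub>M UNIV (\<lambda>_. M)))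
        = expectation (\<lambda>s. (norm (h s - expectation h))\<^sup>2) / real m
          + (norm (v - expectation h))\<^sup>2"
proof -
  note components = indep_vars_PiM_components[OF prob_space_axioms]
  interpret product_prob_space "\<lambda>_. M" "UNIV :: nat set" ..
  have h[measurable]: "h \<in> borel_measurable M" using int by auto
  have comp: "distr (Pi\<^sub>M UNIV (\<lambda>_. M)) M (\<lambda>s. s i) = M" for i :: nat
    using PiM_component[of i] by simp
  have ind: "P.indep_vars (\<lambda>_. borel) (\<lambda>i s. h (s i)) UNIV"
    using P.indep_vars_compose2[OF components, of "\<lambda>_. h" "\<lambda>_. borel"] by simp
  have transfer: "integrable (Pi\<^sub>M UNIV (\<lambda>_. M)) (\<lambda>s. u (s i)) = integrable M u"
      "(\<integral>s. u (s i) \<partial>(Pi\<^sub>M UNIV (\<lambda>_. M))) = integral\<^sup>L M u"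
    if [measurable]: "u \<in> borel_measurable M"
    for u :: "'a \<Rightarrow> 'd::{banach, second_countable_topology}" and i :: nat
    using integrable_distr_eq[of "\<lambda>s. s i" "Pi\<^sub>M UNIV (\<lambda>_. M)" M u]
      integral_distr[of "\<lambda>s. s i" "Pi\<^sub>M UNIV (\<lambda>_. M)" M u] by (simp_all add: comp)
  note mean_error = P.integrable_sample_mean_error P.expectation_sample_mean_error
  let ?\<mu> = "integral\<^sup>L M h"
  note * = mean_error[OF ind, of ?\<mu> "\<integral>s. (norm (h s - ?\<mu>))\<^sup>2 \<partial>M" m v]
  note ** = transfer[of h] transfer[of "\<lambda>s. (norm (h s - ?\<mu>))\<^sup>2"]
  show "integrable (Pi\<^sub>M UNIV (\<lambda>_. M)) (\<lambda>s. (norm (v - (\<Sum>i<m. h (s i)) /\<^sub>R real m))\<^sup>2)"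
    by (rule *(1)) (use int m in \<open>simp_all add: **\<close>)
  show "(\<integral>s. (norm (v - (\<Sum>i<m. h (s i)) /\<^sub>R real m))\<^sup>2 \<partial>(Pi\<^sub>M UNIV (\<lambda>_. M)))
        = (\<integral>s. (norm (h s - ?\<mu>))\<^sup>2 \<partial>M) / real m
          + (norm (v - ?\<mu>))\<^sup>2"
    by (rule *(2)) (use int m in \<open>simp_all add: **\<close>)
qed

text \<open>A Jensen inequality in the extended reals, without prior integrability. It integrates
  \<open>f \<le> f\<^sup>2 / (2 * t) + t / 2\<close>, which is the arithmetic-geometric mean
  inequality.\<close>

lemma (in prob_space) nn_integral_le_of_square:
  assumes [measurable]: "f \<in> borel_measurable M" and q: "0 \<le> q"
    and sq: "(\<integral>\<^sup>+w. (f w)\<^sup>2 \<partial>M) \<le> ennreal (q\<^sup>2)"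
  shows "(\<integral>\<^sup>+w. f w \<partial>M) \<le> ennreal q"
proof (rule ennreal_le_epsilon)
  fix e :: real
  assume "0 < e"
  \<comment> \<open>The optimal choice would be \<open>t = q\<close>; the extra \<open>e\<close>
    keeps the division legitimate when \<open>q = 0\<close>.\<close>
  define t where "t = q + e"
  have t: "0 < t" using q \<open>0 < e\<close> by (simp add: t_def)
  have "f w \<le> ennreal (1 / (2 * t)) * (f w)\<^sup>2 + ennreal (t / 2)" for w
  proof (cases "f w")
    case (real r)
    have "0 \<le> (r - t)\<^sup>2 / (2 * t)" using t by simp
    also have "\<dots> = 1 / (2 * t) * r\<^sup>2 + t / 2 - r"
      using t by (simp add: power2_diff field_simps power2_eq_square)
    finally show ?thesis
      using t real by (simp add: ennreal_power ennreal_mult'[symmetric] ennreal_plus[symmetric]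
          del: ennreal_plus)
  next
    case top
    then show ?thesis using t by (simp add: ennreal_mult_top)
  qed
  then have "(\<integral>\<^sup>+w. f w \<partial>M) \<le> (\<integral>\<^sup>+w. ennreal (1 / (2 * t)) * (f w)\<^sup>2 + ennreal (t / 2) \<partial>M)"
    by (rule nn_integral_mono)
  also have "\<dots> = ennreal (1 / (2 * t)) * (\<integral>\<^sup>+w. (f w)\<^sup>2 \<partial>M) + ennreal (t / 2)"
    by (simp add: nn_integral_add nn_integral_cmult emeasure_space_1)
  also have "\<dots> \<le> ennreal (1 / (2 * t)) * ennreal (q\<^sup>2) + ennreal (t / 2)"
    by (intro add_right_mono mult_left_mono sq) simp
  also have "\<dots> = ennreal (1 / (2 * t) * q\<^sup>2 + t / 2)"
    using t by (simp add: ennreal_mult'[symmetric])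
  also have "\<dots> \<le> ennreal (q + e)"
  proof (rule ennreal_leI)
    have "q\<^sup>2 \<le> t\<^sup>2" using q \<open>0 < e\<close> by (intro power_mono) (auto simp: t_def)
    then have "1 / (2 * t) * q\<^sup>2 + t / 2 \<le> t"
      using t by (simp add: field_simps power2_eq_square)
    then show "1 / (2 * t) * q\<^sup>2 + t / 2 \<le> q + e" by (simp add: t_def)
  qed
  also have "\<dots> = ennreal q + ennreal e"
    using q \<open>0 < e\<close> by simp
  finally show "(\<integral>\<^sup>+w. f w \<partial>M) \<le> ennreal q + ennreal e" .
qed

text \<open>Integrability comes from \<open>norm y \<le> 1 + (norm y)\<^sup>2\<close>. The identity
  follows by expanding around the mean, where the cross term integrates to zero.\<close>

lemma (in prob_space) bias_variance:
  fixes h :: "'a \<Rightarrow> 'b::euclidean_space"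
  assumes [measurable]: "h \<in> borel_measurable M"
    and sq: "integrable M (\<lambda>s. (norm (v - h s))\<^sup>2)"
  shows integrable_of_square_error: "integrable M h"
    and integrable_variance: "integrable M (\<lambda>s. (norm (h s - expectation h))\<^sup>2)"
    and expectation_square_error: "expectation (\<lambda>s. (norm (v - h s))\<^sup>2)
      = expectation (\<lambda>s. (norm (h s - expectation h))\<^sup>2) + (norm (v - expectation h))\<^sup>2"
proof -
  have "integrable M (\<lambda>s. v - h s)"
  proof (rule Bochner_Integration.integrable_bound)
    show "integrable M (\<lambda>s. 1 + (norm (v - h s))\<^sup>2)" using sq by simp
    have "norm y \<le> 1 + (norm y)\<^sup>2" for y :: 'b
    proof -
      have "0 \<le> (norm y - 1)\<^sup>2" by simp
      then have "2 * norm y \<le> (norm y)\<^sup>2 + 1" by (simp add: power2_diff)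
      then show ?thesis using norm_ge_zero[of y] by linarith
    qed
    then show "AE s in M. norm (v - h s) \<le> norm (1 + (norm (v - h s))\<^sup>2)" by simp
  qed simp
  then have "integrable M (\<lambda>s. v - (v - h s))"
    by (rule Bochner_Integration.integrable_diff[rotated]) simp
  moreover have "(\<lambda>s. v - (v - h s)) = h" by auto
  ultimately show int: "integrable M h" by (simp only:)
  let ?\<mu> = "expectation h"
  have eq: "(norm (h s - ?\<mu>))\<^sup>2
      = (norm (v - h s))\<^sup>2 - (norm (v - ?\<mu>))\<^sup>2 + 2 * ((v - ?\<mu>) \<bullet> (h s - ?\<mu>))" for s
    unfolding power2_norm_eq_inner inner_diff_left inner_diff_right
      inner_commute[of "h s" v] inner_commute[of "?\<mu>" v] inner_commute[of "?\<mu>" "h s"]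
    by (simp add: algebra_simps)
  show "integrable M (\<lambda>s. (norm (h s - ?\<mu>))\<^sup>2)"
    unfolding eq using int sq by (intro Bochner_Integration.integrable_add
        Bochner_Integration.integrable_diff integrable_mult_right integrable_inner_right) auto
  show "expectation (\<lambda>s. (norm (v - h s))\<^sup>2)
      = expectation (\<lambda>s. (norm (h s - expectation h))\<^sup>2) + (norm (v - expectation h))\<^sup>2"
    unfolding eq using int sq by (simp add: prob_space)
qed

text \<open>Estimates are carried out in the extended nonnegative reals, where integrability need
  not be known beforehand; a finite bound there yields integrability and the real estimate
  together.\<close>

lemma nn_integral_le_integrable:
  fixes g :: "'a \<Rightarrow> real"
  assumes [measurable]: "g \<in> borel_measurable M" and g: "\<And>w. 0 \<le> g w"
    and le: "(\<integral>\<^sup>+w. ennreal (g w) \<partial>M) \<le> ennreal B" and "0 \<le> B"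
  shows "integrable M g" and "(\<integral>w. g w \<partial>M) \<le> B"
proof -
  show int: "integrable M g"
    using g le by (intro integrableI_nonneg) (auto simp: le_less_trans)
  then show "(\<integral>w. g w \<partial>M) \<le> B"
    using le g \<open>0 \<le> B\<close> by (simp add: nn_integral_eq_integral)
qed

subsection \<open>The expectation problem\<close>

text \<open>To be used with \<open>p = \<beta> ^ (2 * k)\<close>. The ceiling of
  \<open>V / (a\<^sup>2 * p)\<close> is an admissible competitor \<open>b\<close>, so
  \<open>m\<close> is at most a multiple of it. The first conclusion limits the batch size; the
  second prevents the tolerance, a multiple of \<open>sqrt (V / m)\<close>, from falling faster than
  \<open>\<beta> ^ k\<close>.\<close>

lemma economical_batch:
  fixes V V' v a \<kappa> p :: real and m :: nat
  assumes V: "0 < v" "v \<le> V" "V \<le> V'" and a: "0 < a" and p: "0 < p" "p \<le> 1" and m: "1 \<le> m"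
    and \<kappa>: "1 \<le> \<kappa>"
    and econ: "\<And>b. 1 \<le> b \<Longrightarrow> V / real b \<le> a\<^sup>2 * p \<Longrightarrow> real m \<le> \<kappa> * real b"
  shows "real m \<le> \<kappa> * (V' / a\<^sup>2 + 1) / p" and "p / (\<kappa> * (1 / a\<^sup>2 + 1 / v)) \<le> V / real m"
proof -
  define z where "z = V / (a\<^sup>2 * p)"
  have z: "0 < z" using V a p by (simp add: z_def)
  define b where "b = nat \<lceil>z\<rceil>"
  have zb: "z \<le> real b" by (simp add: b_def real_nat_ceiling_ge)
  have "0 < real b" using z zb by linarith
  then have b1: "1 \<le> b" by simp
  have b2: "real b \<le> z + 1" using z by (simp add: b_def)
  have "V / real b \<le> a\<^sup>2 * p"
    using zb b1 a p by (simp add: z_def field_simps)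
  then have m_le: "real m \<le> \<kappa> * (z + 1)"
    using econ[OF b1] mult_left_mono[OF b2, of \<kappa>] \<kappa> by linarith
  have "1 \<le> 1 / p" using p by simp
  have "z + 1 \<le> V' / a\<^sup>2 / p + 1 / p"
    using V a p unfolding z_def by (intro add_mono) (auto simp: field_simps)
  then have "\<kappa> * (z + 1) \<le> \<kappa> * (V' / a\<^sup>2 + 1) / p"
    using mult_left_mono[of "z + 1" "V' / a\<^sup>2 / p + 1 / p" \<kappa>] \<kappa> a p by (simp add: field_simps)
  with m_le show "real m \<le> \<kappa> * (V' / a\<^sup>2 + 1) / p" by linarith
  \<comment> \<open>The lower bound \<open>v\<close> lets the rounding term 1 be absorbed into a
    multiple of \<open>V / p\<close>. The bound on \<open>m\<close> becomes proportional to
    \<open>V\<close>, which then cancels in \<open>V / m\<close>.\<close>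
  have "1 \<le> V / v" using V by simp
  then have "1 \<le> V / v * (1 / p)" using mult_mono[of 1 "V / v" 1 "1 / p"] \<open>1 \<le> 1 / p\<close> by simp
  then have "z + 1 \<le> V * (1 / a\<^sup>2 + 1 / v) / p"
    by (simp add: z_def field_simps add_divide_distrib)
  then have "real m \<le> \<kappa> * (V * (1 / a\<^sup>2 + 1 / v) / p)"
    using m_le \<kappa> mult_left_mono[of "z + 1" "V * (1 / a\<^sup>2 + 1 / v) / p" \<kappa>] by linarith
  then have "real m * p \<le> V * (\<kappa> * (1 / a\<^sup>2 + 1 / v))"
    using p by (simp add: pos_le_divide_eq mult_ac)
  moreover have "0 < \<kappa> * (1 / a\<^sup>2 + 1 / v)" using \<kappa> a V by (simp add: add_pos_pos)
  ultimately show "p / (\<kappa> * (1 / a\<^sup>2 + 1 / v)) \<le> V / real m"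
    using m by (simp add: divide_le_eq pos_le_divide_eq mult_ac)
qed

context ra_expectation
begin

sublocale P: prob_space P by (rule prob_P)
sublocale M: prob_space M by (rule prob_M)
sublocale draws: product_prob_space "\<lambda>_. P" "UNIV :: nat set" ..

abbreviation hist :: "nat \<Rightarrow> 'w measure" where
  "hist k \<equiv> history M P n xi k"

abbreviation stream :: "(nat \<Rightarrow> 's) measure" where
  "stream \<equiv> Pi\<^sub>M UNIV (\<lambda>_. P)"

abbreviation f :: "real^'n \<Rightarrow> real" where
  "f \<equiv> expectation_obj P F"

abbreviation residual :: "'w \<Rightarrow> nat \<Rightarrow> real" where
  "residual w k \<equiv> norm (kkt_res (grad f) c (x w k 0) (prev_dual l0 (lam w) (N w) k))"

section \<open>History, fresh draws and their independence\<close>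

lemma space_history [simp]: "space (hist k) = space M"
  unfolding history_def by (rule space_measure_of) auto

text \<open>Strong induction is needed because the generating events up to \<open>k\<close> involve
  earlier batch sizes \<open>n w j\<close>, whose measurability is known only relative to
  \<open>hist j\<close>.\<close>

lemma subalgebra_history: "subalgebra M (hist k)"
proof (induction k rule: less_induct)
  case (less k)
  have "{w \<in> space M. i < n w j \<and> xi w j i \<in> A} \<in> sets M" if "j < k" "A \<in> sets P" for i j A
  proof -
    have [measurable]: "(\<lambda>w. n w j) \<in> measurable M (count_space UNIV)"
      by (rule measurable_from_subalg[OF less[OF \<open>j < k\<close>] adapted(1)])
    have [measurable]: "(\<lambda>w. xi w j i) \<in> measurable M P" by (rule draws_distr)
    show ?thesis using that by measurable
  qed
  then show ?case
    unfolding subalgebra_def space_history history_def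
    by (auto intro!: sets.sigma_sets_subset simp: sets_measure_of_conv)
qed

lemma measurable_history_imp:
  "g \<in> measurable (hist k) B \<Longrightarrow> g \<in> measurable M B"
  by (rule measurable_from_subalg[OF subalgebra_history])

lemma draws_measurable: "(\<lambda>w. xi w k) \<in> measurable M stream"
  using measurable_restrict[of UNIV "\<lambda>i w. xi w k i" M "\<lambda>_. P"] draws_distr(1)
  by (simp add: restrict_UNIV)

lemma distr_draws: "distr M stream (\<lambda>w. xi w k) = stream"
  using M.indep_vars_iff_distr_eq_PiM[where I = UNIV and M' = "\<lambda>_. P" and X = "\<lambda>i w. xi w k i"] draws_indep[of k]
    draws_distr by (simp add: restrict_UNIV)

lemma measurable_ident_history: "(\<lambda>w. w) \<in> measurable M (hist k)"
  by (rule measurable_history_imp[of _ k]) simp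

text \<open>The first factor is \<open>M\<close> seen through the coarser \<open>hist k\<close>,
  written as its image under the identity. On a rectangle the claim is the product formula for a
  history event and an event of the fresh stream.\<close>

lemma distr_history_draws:
  "distr M (hist k \<Otimes>\<^sub>M stream) (\<lambda>w. (w, xi w k)) = distr M (hist k) (\<lambda>w. w) \<Otimes>\<^sub>M stream"
proof (rule sym, rule pair_measure_eqI)
  interpret D: prob_space "distr M (hist k) (\<lambda>w. w)"
    by (rule M.prob_space_distr[OF measurable_ident_history])
  show "sigma_finite_measure (distr M (hist k) (\<lambda>w. w))" "sigma_finite_measure stream"
    by unfold_locales
  show "sets (distr M (hist k) (\<lambda>w. w) \<Otimes>\<^sub>M stream)
      = sets (distr M (hist k \<Otimes>\<^sub>M stream) (\<lambda>w. (w, xi w k)))"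
    by (simp cong: sets_pair_measure_cong)
  note [measurable] = measurable_ident_history draws_measurable
  fix A B
  assume "A \<in> sets (distr M (hist k) (\<lambda>w. w))" and B[measurable]: "B \<in> sets stream"
  then have A[measurable]: "A \<in> sets (hist k)" by simp
  then have AM: "A \<in> sets M" using subalgebra_history[of k] by (auto simp: subalgebra_def)
  define B' where "B' = (\<lambda>w. xi w k) -` B \<inter> space M"
  have B'M: "B' \<in> sets M" unfolding B'_def by measurable
  have "B' \<in> sets (vimage_algebra (space M) (\<lambda>w. xi w k) stream)"
    unfolding B'_def by (rule in_vimage_algebra[OF B])
  then have "M.prob (A \<inter> B') = M.prob A * M.prob B'"
    using draws_indep_history[of k] A unfolding M.indep_sets2_eq by blast
  then have "emeasure M (A \<inter> B') = emeasure M A * emeasure M B'"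
    by (simp add: M.emeasure_eq_measure ennreal_mult)
  moreover have "emeasure M B' = emeasure stream B"
    using emeasure_distr[OF draws_measurable[of k] B] by (simp add: distr_draws B'_def)
  moreover have "emeasure (distr M (hist k) (\<lambda>w. w)) A = emeasure M A"
    using sets.sets_into_space[OF AM] by (simp add: emeasure_distr Int_absorb2)
  moreover have "emeasure (distr M (hist k \<Otimes>\<^sub>M stream) (\<lambda>w. (w, xi w k))) (A \<times> B)
      = emeasure M (A \<inter> B')"
    using sets.sets_into_space[OF AM]
    by (subst emeasure_distr) (auto intro!: arg_cong[where f = "emeasure M"] simp: B'_def)
  ultimately show "emeasure (distr M (hist k) (\<lambda>w. w)) A * emeasure stream B
      = emeasure (distr M (hist k \<Otimes>\<^sub>M stream) (\<lambda>w. (w, xi w k))) (A \<times> B)"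
    by simp
qed

text \<open>Independence lets one freeze the history and average over the fresh sample only.\<close>

lemma nn_integral_freeze_history:
  assumes [measurable]: "\<phi> \<in> borel_measurable (hist k \<Otimes>\<^sub>M stream)"
  shows "(\<integral>\<^sup>+w. \<phi> (w, xi w k) \<partial>M) = (\<integral>\<^sup>+w. \<integral>\<^sup>+s. \<phi> (w, s) \<partial>stream \<partial>M)"
proof -
  note [measurable] = draws_measurable[of k] measurable_ident_history[of k]
  interpret D: prob_space "distr M (hist k) (\<lambda>w. w)"
    by (rule M.prob_space_distr) measurable
  have "(\<integral>\<^sup>+w. \<phi> (w, xi w k) \<partial>M)
      = integral\<^sup>N (distr M (hist k \<Otimes>\<^sub>M stream) (\<lambda>w. (w, xi w k))) \<phi>"
    by (subst nn_integral_distr) auto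
  also have "\<dots> = (\<integral>\<^sup>+w. \<integral>\<^sup>+s. \<phi> (w, s) \<partial>stream \<partial>distr M (hist k) (\<lambda>w. w))"
    unfolding distr_history_draws
    by (rule draws.P.nn_integral_fst[symmetric]) (simp cong: measurable_cong_sets sets_pair_measure_cong)
  also have "\<dots> = (\<integral>\<^sup>+w. \<integral>\<^sup>+s. \<phi> (w, s) \<partial>stream \<partial>M)"
    by (subst nn_integral_distr) (auto intro!: draws.P.borel_measurable_nn_integral)
  finally show ?thesis .
qed

section \<open>Measurability of iterates, residuals and sampled gradients\<close>

lemma grad_f_measurable: "grad f \<in> borel_measurable (restrict_space borel X)"
  using regular by (auto simp: regular_problem_def intro: borel_measurable_continuous_on_restrict)

text \<open>The gradient and the Jacobian are controlled on \<open>X\<close> only, so iterates are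
  regarded as maps into the trace of the Borel sets on \<open>X\<close>; compositions with these
  functions then become measurable.\<close>

lemma iterate_measurable: "(\<lambda>w. x w k 0) \<in> measurable (hist k) (restrict_space borel X)"
  using adapted(2)[of k] iterates_in[of _ 0 k] by (intro measurable_restrict_space2) auto

lemma residual_measurable: "(\<lambda>w. residual w k) \<in> borel_measurable (hist k)"
proof -
  note [measurable] = grad_f_measurable iterate_measurable adapted(3)[of k]
  have [measurable]: "(\<lambda>y. jacobian c (at y)) \<in> borel_measurable (restrict_space borel X)"
    using regular by (auto simp: regular_problem_def intro: borel_measurable_continuous_on_restrict)
  have "continuous_on X c"
    using regular
    by (auto simp: regular_problem_def intro!: continuous_at_imp_continuous_on differentiable_imp_continuous_within)
  then have [measurable]: "c \<in> borel_measurable (restrict_space borel X)"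
    by (rule borel_measurable_continuous_on_restrict)
  \<comment> \<open>The matrix-vector product is jointly continuous in matrix and vector, hence
    measurable in the pair.\<close>
  have mv: "(\<lambda>w. transpose (A w) *v l w) \<in> borel_measurable B"
    if [measurable]: "A \<in> borel_measurable B" "l \<in> borel_measurable B"
    for A :: "'w \<Rightarrow> real^'n^'m" and l B
  proof (rule borel_measurable_continuous_Pair[OF that])
    show "continuous_on UNIV (\<lambda>p. transpose (fst p :: real^'n^'m) *v snd p)"
      unfolding matrix_vector_mult_def transpose_def vec_lambda_beta
      by (intro continuous_intros)
  qed
  have [measurable]: "(\<lambda>w. transpose (jacobian c (at (x w k 0))) *v prev_dual l0 (lam w) (N w) k)
      \<in> borel_measurable (hist k)"
    by (rule mv) measurable
  show ?thesis
    unfolding kkt_res_def norm_Pair by measurable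
qed

lemma component_grad_measurable_at:
  assumes "y \<in> X"
  shows "(\<lambda>s. grad (\<lambda>z. F z s) y) \<in> borel_measurable P"
proof -
  have "Pair y \<in> measurable P (restrict_space borel X \<Otimes>\<^sub>M P)"
    using assms by (intro measurable_Pair1') (simp add: space_restrict_space)
  from measurable_compose[OF this component_grad_measurable] show ?thesis by simp
qed

text \<open>The number of summands is random. Measurability is shown for each fixed batch size and
  then glued over its countably many values.\<close>

lemma sample_grad_measurable:
  "(\<lambda>p. sample_grad F {..<n (fst p) k} (snd p) (x (fst p) k 0)) \<in> borel_measurable (hist k \<Otimes>\<^sub>M stream)"
proof -
  note [measurable] = iterate_measurable[of k] adapted(1)[of k] component_grad_measurable
  have "(\<lambda>p. (\<lambda>(y, s). grad (\<lambda>z. F z s) y) (x (fst p) k 0, snd p i))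
      \<in> borel_measurable (hist k \<Otimes>\<^sub>M stream)" for i
    by measurable
  then have [measurable]: "(\<lambda>p. grad (\<lambda>z. F z (snd p i)) (x (fst p) k 0))
      \<in> borel_measurable (hist k \<Otimes>\<^sub>M stream)" for i
    by simp
  have "(\<lambda>p. sample_grad F {..<m} (snd p) (x (fst p) k 0))
      \<in> borel_measurable (hist k \<Otimes>\<^sub>M stream)" for m
    unfolding sample_grad_def by measurable
  then show ?thesis
    by (rule measurable_compose_countable) measurable
qed

lemma sample_grad_measurable_at:
  assumes "w \<in> space M"
  shows "(\<lambda>s. sample_grad F {..<n w k} s (x w k 0)) \<in> borel_measurable stream"
proof -
  have "Pair w \<in> measurable stream (hist k \<Otimes>\<^sub>M stream)"
    using assms by (intro measurable_Pair1') simp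
  from measurable_compose[OF this sample_grad_measurable] show ?thesis by simp
qed

lemma sample_grad_draws_measurable:
  "(\<lambda>w. sample_grad F {..<n w k} (xi w k) (x w k 0)) \<in> borel_measurable M"
proof -
  note [measurable] = draws_measurable[of k] measurable_ident_history[of k]
  have "(\<lambda>w. (w, xi w k)) \<in> measurable M (hist k \<Otimes>\<^sub>M stream)" by measurable
  from measurable_compose[OF this sample_grad_measurable] show ?thesis by simp
qed

lemma grad_iterate_measurable: "(\<lambda>w. grad f (x w k 0)) \<in> borel_measurable (hist k)"
  by (rule measurable_compose[OF iterate_measurable grad_f_measurable])

section \<open>Conditional mean squared error and uniform deviation\<close>

abbreviation mean_grad :: "real^'n \<Rightarrow> real^'n" where
  "mean_grad y \<equiv> (\<integral>s. grad (\<lambda>z. F z s) y \<partial>P)"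

text \<open>Both claims split a mean square about \<open>grad f y\<close> into variance and squared
  bias: dropping the bias gives the first, averaging \<open>m\<close> draws the second.\<close>

lemma
  assumes y: "y \<in> X"
  shows grad_var_le: "grad_var P F y \<le> \<omega>1\<^sup>2 * (norm (grad f y))\<^sup>2 + \<omega>2\<^sup>2"
    and nn_integral_sampling_error: "0 < m \<Longrightarrow>
      (\<integral>\<^sup>+s. ennreal ((norm (grad f y - sample_grad F {..<m} s y))\<^sup>2) \<partial>stream)
        = ennreal (grad_var P F y / real m + (norm (grad f y - mean_grad y))\<^sup>2)"
proof -
  note meas = component_grad_measurable_at[OF y]
  note sq = component_grads(1)[OF y]
  have "grad_var P F y
      \<le> (\<integral>s. (norm (grad f y - grad (\<lambda>z. F z s) y))\<^sup>2 \<partial>P)"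
    unfolding grad_var_def P.expectation_square_error[OF meas sq] by simp
  then show "grad_var P F y \<le> \<omega>1\<^sup>2 * (norm (grad f y))\<^sup>2 + \<omega>2\<^sup>2"
    using component_grads(2)[OF y] by linarith
  assume m: "0 < m"
  note int = P.integrable_of_square_error[OF meas sq] P.integrable_variance[OF meas sq]
  have "sample_grad F {..<m} s y = (\<Sum>i<m. grad (\<lambda>z. F z (s i)) y) /\<^sub>R real m" for s
    by (simp add: sample_grad_def)
  then show "(\<integral>\<^sup>+s. ennreal ((norm (grad f y - sample_grad F {..<m} s y))\<^sup>2) \<partial>stream)
      = ennreal (grad_var P F y / real m + (norm (grad f y - mean_grad y))\<^sup>2)"
    using P.integrable_PiM_sample_mean_error[OF int m, of "grad f y"]
      P.integral_PiM_sample_mean_error[OF int m, of "grad f y"]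
    by (simp add: nn_integral_eq_integral grad_var_def)
qed

lemma grad_var_nonneg: "0 \<le> grad_var P F y"
  unfolding grad_var_def by simp

lemma iterate_in: "w \<in> space M \<Longrightarrow> x w k 0 \<in> X"
  using iterates_in by blast

text \<open>The mean squared error of the sampled gradient given the history; its second summand is the
  squared bias, which vanishes for unbiased component gradients.\<close>

definition sampling_mse :: "'w \<Rightarrow> nat \<Rightarrow> real" where
  "sampling_mse w k = grad_var P F (x w k 0) / real (n w k)
     + (norm (grad f (x w k 0) - mean_grad (x w k 0)))\<^sup>2"

lemma sampling_mse_nonneg: "0 \<le> sampling_mse w k"
  unfolding sampling_mse_def by (simp add: grad_var_nonneg)

abbreviation sampling_error :: "'w \<Rightarrow> nat \<Rightarrow> (nat \<Rightarrow> 's) \<Rightarrow> real" where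
  "sampling_error w k s \<equiv> norm (grad f (x w k 0) - sample_grad F {..<n w k} s (x w k 0))"

lemma nn_integral_sampling_mse:
  assumes "w \<in> space M"
  shows "(\<integral>\<^sup>+s. ennreal ((sampling_error w k s)\<^sup>2) \<partial>stream) = ennreal (sampling_mse w k)"
  using nn_integral_sampling_error[OF iterate_in[OF assms], of "n w k"] batch_pos[OF assms, of k]
  by (simp add: sampling_mse_def)

text \<open>Freezing the history identifies the conditional expectation in the sampling condition
  with \<open>sampling_mse\<close>, by testing against history events. The condition then bounds it
  by a perfect square.\<close>

lemma AE_sampling_mse_le:
  "AE w in M. sampling_mse w k \<le> (\<theta> * residual w k + a * \<beta> ^ k)\<^sup>2"
proof -
  interpret sub: finite_measure_subalgebra M "hist k"
    by unfold_locales (rule subalgebra_history)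
  let ?e = "\<lambda>w. (sampling_error w k (xi w k))\<^sup>2"
  note [measurable] = sample_grad_measurable[of k] sample_grad_measurable_at[of _ k]
    sample_grad_draws_measurable[of k] grad_iterate_measurable[of k]
    measurable_history_imp[OF grad_iterate_measurable[of k]]
  let ?I = "\<lambda>w. \<integral>\<^sup>+s. ennreal ((sampling_error w k s)\<^sup>2) \<partial>stream"
  have I[measurable]: "?I \<in> borel_measurable (hist k)"
    using draws.P.borel_measurable_nn_integral[of "\<lambda>w s. ennreal ((sampling_error w k s)\<^sup>2)" "hist k"]
    by (simp add: case_prod_beta')
  have "AE w in M. ?I w = nn_cond_exp M (hist k) (\<lambda>w. ennreal (?e w)) w"
  proof (rule sub.nn_cond_exp_charact)
    fix A assume A[measurable]: "A \<in> sets (hist k)"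
    have "(\<integral>\<^sup>+ w \<in> A. ennreal (?e w) \<partial>M)
        = (\<integral>\<^sup>+ w. \<integral>\<^sup>+ s. ennreal ((sampling_error w k s)\<^sup>2) * indicator A w \<partial>stream \<partial>M)"
      using nn_integral_freeze_history[where k = k and
          \<phi> = "\<lambda>p. ennreal ((sampling_error (fst p) k (snd p))\<^sup>2) * indicator A (fst p)"]
      by simp
    also have "\<dots> = (\<integral>\<^sup>+ w \<in> A. ?I w \<partial>M)"
    proof (rule nn_integral_cong)
      fix w assume [measurable]: "w \<in> space M"
      show "(\<integral>\<^sup>+ s. ennreal ((sampling_error w k s)\<^sup>2) * indicator A w \<partial>stream)
          = ?I w * indicator A w"
        by (intro nn_integral_multc) measurable
    qed
    finally show "(\<integral>\<^sup>+ w \<in> A. ennreal (?e w) \<partial>M) = (\<integral>\<^sup>+ w \<in> A. ?I w \<partial>M)" .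
  qed measurable
  \<comment> \<open>The real conditional expectation is the difference of those of the positive and
    negative parts; the negative part of a square is zero.\<close>
  moreover have "AE w in M. (0 :: ennreal) = nn_cond_exp M (hist k) (\<lambda>w. ennreal (- ?e w)) w"
    using sub.nn_cond_exp_F_meas[of "\<lambda>_. 0"] by (simp add: ennreal_neg)
  ultimately have "AE w in M. real_cond_exp M (hist k) ?e w = sampling_mse w k"
    using AE_space
  proof eventually_elim
    case (elim w)
    have "real_cond_exp M (hist k) ?e w = enn2real (?I w)"
      using elim(1,2) unfolding real_cond_exp_def by simp
    then show ?case
      using nn_integral_sampling_mse[OF elim(3), of k] sampling_mse_nonneg[of w k] by simp
  qed
  with sampling[of k] show ?thesis
  proof eventually_elim
    case (elim w)
    have "\<theta>\<^sup>2 * (residual w k)\<^sup>2 + a\<^sup>2 * \<beta> ^ (2 * k) \<le> (\<theta> * residual w k + a * \<beta> ^ k)\<^sup>2"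
      using sampling_params by (intro sampling_tolerance_le_square) simp_all
    with elim show ?case by simp
  qed
qed

text \<open>With the history frozen, the first moment over the fresh sample is bounded by the root
  of its second moment.\<close>

lemma nn_integral_sampling_error_le:
  "(\<integral>\<^sup>+w. ennreal (sampling_error w k (xi w k)) \<partial>M)
    \<le> (\<integral>\<^sup>+w. ennreal (\<theta> * residual w k + a * \<beta> ^ k) \<partial>M)"
proof -
  note [measurable] = sample_grad_measurable[of k] sample_grad_measurable_at[of _ k]
    grad_iterate_measurable[of k]
  have "(\<integral>\<^sup>+w. ennreal (sampling_error w k (xi w k)) \<partial>M)
      = (\<integral>\<^sup>+w. \<integral>\<^sup>+s. ennreal (sampling_error w k s) \<partial>stream \<partial>M)"
    using nn_integral_freeze_history[where k = k and
        \<phi> = "\<lambda>p. ennreal (sampling_error (fst p) k (snd p))"] by simp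
  also have "\<dots> \<le> (\<integral>\<^sup>+w. ennreal (\<theta> * residual w k + a * \<beta> ^ k) \<partial>M)"
  proof (rule nn_integral_mono_AE, use AE_sampling_mse_le[of k] AE_space in eventually_elim)
    case (elim w)
    note [measurable] = elim(2)
    show ?case
    proof (rule draws.P.nn_integral_le_of_square)
      show "(\<integral>\<^sup>+s. (ennreal (sampling_error w k s))\<^sup>2 \<partial>stream)
          \<le> ennreal ((\<theta> * residual w k + a * \<beta> ^ k)\<^sup>2)"
        using nn_integral_sampling_mse[OF elim(2), of k] elim(1)
        by (simp add: ennreal_power ennreal_leI)
      show "(\<lambda>s. ennreal (sampling_error w k s)) \<in> borel_measurable stream" by measurable
    qed (use sampling_params in simp)
  qed
  finally show ?thesis .
qed

text \<open>\<open>grad_dev\<close> is only known to be measurable on the finite product over \<open>{..<b}\<close>, which is why the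
  sample stream is restricted to the entries in use.\<close>

abbreviation deviation :: "real \<Rightarrow> 'w \<Rightarrow> nat \<Rightarrow> (nat \<Rightarrow> 's) \<Rightarrow> ennreal" where
  "deviation eG w k s \<equiv> grad_dev X f F eG (n w k) (restrict s {..<n w k})"

lemma sample_grad_restrict: "sample_grad F I (restrict s I) y = sample_grad F I s y"
  unfolding sample_grad_def by simp

text \<open>The end point of an inner loop depends on the very sample whose error is measured there,
  so it cannot be frozen as the start point can. A supremum over \<open>X\<close> removes this
  dependence.\<close>

lemma sampling_error_le_deviation:
  assumes eG: "0 < eG" and y: "y \<in> X" "norm (grad f y) \<le> \<kappa>g"
  shows "ennreal (norm (grad f y - sample_grad F {..<n w k} s y))
    \<le> ennreal (eG + \<kappa>g) * deviation eG w k s"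
proof -
  have pos: "0 < eG + norm (grad f y)" using eG by (simp add: add_pos_nonneg)
  have "ennreal (norm (grad f y - sample_grad F {..<n w k} s y))
      = ennreal (eG + norm (grad f y))
        * ennreal (norm (grad f y - sample_grad F {..<n w k} s y) / (eG + norm (grad f y)))"
    using pos by (simp add: ennreal_mult'[symmetric] del: ennreal_plus)
  also have "\<dots> \<le> ennreal (eG + \<kappa>g) * deviation eG w k s"
  proof (rule mult_mono)
    show "ennreal (norm (grad f y - sample_grad F {..<n w k} s y) / (eG + norm (grad f y)))
        \<le> deviation eG w k s"
      unfolding grad_dev_def sample_grad_restrict by (rule SUP_upper[OF y(1)])
    show "ennreal (eG + norm (grad f y)) \<le> ennreal (eG + \<kappa>g)"
      using y by (intro ennreal_leI) simp
  qed auto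
  finally show ?thesis .
qed

text \<open>Again glued over the values of the batch size. Size 0 receives the dummy value 0, since
  measurability is given from size 1 on; positivity of batches makes the two functions
  agree.\<close>

lemma deviation_measurable:
  assumes dev: "\<And>b. 1 \<le> b \<Longrightarrow> grad_dev X f F eG b \<in> borel_measurable (Pi\<^sub>M {..<b} (\<lambda>i. P))"
  shows "(\<lambda>p. deviation eG (fst p) k (snd p)) \<in> borel_measurable (hist k \<Otimes>\<^sub>M stream)"
proof -
  note [measurable] = adapted(1)[of k]
  have "(\<lambda>p. if b = 0 then 0 else grad_dev X f F eG b (restrict (snd p) {..<b}))
      \<in> borel_measurable (hist k \<Otimes>\<^sub>M stream)" for b
  proof (cases "b = 0")
    case False
    then have [measurable]: "grad_dev X f F eG b \<in> borel_measurable (Pi\<^sub>M {..<b} (\<lambda>i. P))"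
      by (intro dev) simp
    have "(\<lambda>p. grad_dev X f F eG b (restrict (snd p) {..<b})) \<in> borel_measurable (hist k \<Otimes>\<^sub>M stream)"
      by measurable
    with False show ?thesis by simp
  qed simp
  then have "(\<lambda>p. if n (fst p) k = 0 then 0 else deviation eG (fst p) k (snd p))
      \<in> borel_measurable (hist k \<Otimes>\<^sub>M stream)"
    by (rule measurable_compose_countable) measurable
  then show ?thesis
  proof (rule measurable_cong[THEN iffD1, rotated])
    fix p assume "p \<in> space (hist k \<Otimes>\<^sub>M stream)"
    then have "fst p \<in> space M" by (auto simp: space_pair_measure)
    from batch_pos[OF this, of k]
    show "(if n (fst p) k = 0 then 0 else deviation eG (fst p) k (snd p)) = deviation eG (fst p) k (snd p)"
      by simp
  qed
qed

text \<open>The variance lower bound converts \<open>\<kappa>G\<^sup>2 / b\<close> into at most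
  \<open>sampling_mse w k / \<kappa>\<sigma>\<^sup>2\<close>, so the sampling condition at the start
  point also controls the uniform deviation.\<close>

lemma nn_integral_deviation_le:
  assumes G: "0 < \<kappa>G" and s: "0 < \<kappa>\<sigma>"
    and dev: "\<And>b. 1 \<le> b \<Longrightarrow> grad_dev X f F eG b \<in> borel_measurable (Pi\<^sub>M {..<b} (\<lambda>i. P))"
    and sq: "\<And>b. 1 \<le> b \<Longrightarrow> (\<integral>\<^sup>+s. (grad_dev X f F eG b s)\<^sup>2 \<partial>(Pi\<^sub>M {..<b} (\<lambda>i. P)))
      \<le> ennreal (\<kappa>G\<^sup>2 / real b)"
    and var: "AE w in M. \<kappa>G\<^sup>2 * \<kappa>\<sigma>\<^sup>2 \<le> grad_var P F (x w k 0)"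
  shows "(\<integral>\<^sup>+w. deviation eG w k (xi w k) \<partial>M)
    \<le> (\<integral>\<^sup>+w. ennreal ((\<theta> * residual w k + a * \<beta> ^ k) / \<kappa>\<sigma>) \<partial>M)"
proof -
  have "(\<integral>\<^sup>+w. deviation eG w k (xi w k) \<partial>M) = (\<integral>\<^sup>+w. \<integral>\<^sup>+s. deviation eG w k s \<partial>stream \<partial>M)"
    using nn_integral_freeze_history[OF deviation_measurable[OF dev]] by simp
  also have "\<dots> \<le> (\<integral>\<^sup>+w. ennreal ((\<theta> * residual w k + a * \<beta> ^ k) / \<kappa>\<sigma>) \<partial>M)"
  proof (rule nn_integral_mono_AE, use AE_sampling_mse_le[of k] var AE_space in eventually_elim)
    case (elim w)
    define b where "b = n w k"
    have b: "1 \<le> b" unfolding b_def by (rule batch_pos[OF elim(3)])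
    note [measurable] = dev[OF b]
    have "(\<integral>\<^sup>+s. (deviation eG w k s)\<^sup>2 \<partial>stream)
        = (\<integral>\<^sup>+s. (grad_dev X f F eG b s)\<^sup>2 \<partial>distr stream (Pi\<^sub>M {..<b} (\<lambda>i. P)) (\<lambda>s. restrict s {..<b}))"
      unfolding b_def[symmetric] by (rule nn_integral_distr[symmetric]) measurable
    also have "\<dots> \<le> ennreal (\<kappa>G\<^sup>2 / real b)"
      using sq[OF b] draws.distr_PiM_restrict_finite[of "{..<b}"] by simp
    also have "\<dots> \<le> ennreal (((\<theta> * residual w k + a * \<beta> ^ k) / \<kappa>\<sigma>)\<^sup>2)"
    proof (rule ennreal_leI)
      have "\<kappa>G\<^sup>2 * \<kappa>\<sigma>\<^sup>2 / real b \<le> sampling_mse w k"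
        unfolding sampling_mse_def b_def[symmetric] using elim(2)
        by (intro add_increasing2 divide_right_mono) auto
      with elim(1) have "\<kappa>G\<^sup>2 * \<kappa>\<sigma>\<^sup>2 / real b \<le> (\<theta> * residual w k + a * \<beta> ^ k)\<^sup>2"
        by linarith
      then show "\<kappa>G\<^sup>2 / real b \<le> ((\<theta> * residual w k + a * \<beta> ^ k) / \<kappa>\<sigma>)\<^sup>2"
        using s by (simp add: power_divide pos_le_divide_eq)
    qed
    finally have "(\<integral>\<^sup>+s. (deviation eG w k s)\<^sup>2 \<partial>stream)
        \<le> ennreal (((\<theta> * residual w k + a * \<beta> ^ k) / \<kappa>\<sigma>)\<^sup>2)" .
    moreover have "(\<lambda>s. deviation eG w k s) \<in> borel_measurable stream"
      unfolding b_def[symmetric] by measurable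
    moreover have "0 \<le> (\<theta> * residual w k + a * \<beta> ^ k) / \<kappa>\<sigma>"
      using s sampling_params by simp
    ultimately show ?case
      by (rule draws.P.nn_integral_le_of_square[rotated 2])
  qed
  finally show ?thesis .
qed

section \<open>One-step recursion for the expected residual\<close>

lemma residual_Suc:
  "w \<in> space M \<Longrightarrow>
    residual w (Suc k) = norm (kkt_res (grad f) c (x w k (N w k)) (lam w k (N w k)))"
  using ra_runD(3)[OF run] by simp

text \<open>The estimate holds for each outcome and separates a part determined by the history from
  two terms containing the fresh sample, which are averaged later.\<close>

lemma residual_Suc_le:
  assumes w: "w \<in> space M" and mse: "sampling_mse w k \<le> (\<theta> * residual w k + a * \<beta> ^ k)\<^sup>2"
    and \<omega>: "0 < \<omega>" and eG: "0 < eG" and gam: "gam w k \<le> \<gamma>"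
    and eps: "eps w k = \<omega> * sqrt (grad_var P F (x w k 0) / real (n w k))"
  shows "ennreal (residual w (Suc k))
    \<le> ennreal (\<gamma> * residual w k + \<omega> * (\<theta> * residual w k + a * \<beta> ^ k))
      + (ennreal \<gamma> * ennreal (sampling_error w k (xi w k))
         + ennreal (eG + \<kappa>g) * deviation eG w k (xi w k))"
proof -
  let ?q = "\<theta> * residual w k + a * \<beta> ^ k"
  let ?d = "norm (grad f (x w k (N w k)) - sample_grad F {..<n w k} (xi w k) (x w k (N w k)))"
  have \<gamma>: "0 \<le> \<gamma>" using ra_runD(1)[OF run[OF w], of k] gam by simp
  have q: "0 \<le> ?q" using sampling_params by simp
  \<comment> \<open>Discarding the squared bias leaves the variance over the batch size, the
    quantity under the root in \<open>eps w k\<close>.\<close>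
  have "grad_var P F (x w k 0) / real (n w k) \<le> ?q\<^sup>2"
    using mse by (simp add: sampling_mse_def) (smt (verit) zero_le_power2)
  then have "sqrt (grad_var P F (x w k 0) / real (n w k)) \<le> ?q"
    using q by (intro real_le_lsqrt) (simp_all add: grad_var_nonneg)
  then have "eps w k \<le> \<omega> * ?q" unfolding eps using \<omega> by (intro mult_left_mono) auto
  moreover have "rank (jacobian c (at (x w k 0))) = CARD('m)"
    using regular iterate_in[OF w, of k] by (auto simp: regular_problem_def)
  from ra_run_residual_step[where h = "grad f" and \<gamma> = \<gamma>, OF run[OF w] this gam]
  have "residual w (Suc k)
      \<le> \<gamma> * (residual w k + sampling_error w k (xi w k)) + eps w k + ?d" .
  ultimately have "residual w (Suc k)
      \<le> (\<gamma> * residual w k + \<omega> * ?q) + (\<gamma> * sampling_error w k (xi w k) + ?d)"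
    by (simp add: distrib_left)
  then have "ennreal (residual w (Suc k))
      \<le> ennreal ((\<gamma> * residual w k + \<omega> * ?q) + (\<gamma> * sampling_error w k (xi w k) + ?d))"
    by (rule ennreal_leI)
  also have "\<dots> = ennreal (\<gamma> * residual w k + \<omega> * ?q)
      + (ennreal \<gamma> * ennreal (sampling_error w k (xi w k)) + ennreal ?d)"
    using \<gamma> \<omega> q by (simp add: ennreal_mult)
  also have "\<dots> \<le> ennreal (\<gamma> * residual w k + \<omega> * ?q)
      + (ennreal \<gamma> * ennreal (sampling_error w k (xi w k))
         + ennreal (eG + \<kappa>g) * deviation eG w k (xi w k))"
    using sampling_error_le_deviation[OF eG iterates_in[OF w order_refl] grad_bound(2)[OF w]]
    by (intro add_left_mono)
  finally show ?thesis .
qed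

lemma expectation_residual_Suc:
  assumes int: "integrable M (\<lambda>w. residual w k)"
    and eG: "0 < eG" and \<omega>: "0 < \<omega>" and G: "0 < \<kappa>G" and s: "0 < \<kappa>\<sigma>"
    and dev: "\<And>b. 1 \<le> b \<Longrightarrow> grad_dev X f F eG b \<in> borel_measurable (Pi\<^sub>M {..<b} (\<lambda>i. P))"
    and sq: "\<And>b. 1 \<le> b \<Longrightarrow> (\<integral>\<^sup>+s. (grad_dev X f F eG b s)\<^sup>2 \<partial>(Pi\<^sub>M {..<b} (\<lambda>i. P)))
      \<le> ennreal (\<kappa>G\<^sup>2 / real b)"
    and var: "AE w in M. \<kappa>G\<^sup>2 * \<kappa>\<sigma>\<^sup>2 \<le> grad_var P F (x w k 0)"
    and gam: "\<And>w. w \<in> space M \<Longrightarrow> gam w k \<le> \<gamma>"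
    and eps: "\<And>w. w \<in> space M \<Longrightarrow>
      eps w k = \<omega> * sqrt (grad_var P F (x w k 0) / real (n w k))"
  shows "integrable M (\<lambda>w. residual w (Suc k))"
    and "(\<integral>w. residual w (Suc k) \<partial>M)
      \<le> (\<gamma> + \<theta> * (\<omega> + (eG + \<kappa>g) / \<kappa>\<sigma> + \<gamma>)) * (\<integral>w. residual w k \<partial>M)
        + a * (\<omega> + (eG + \<kappa>g) / \<kappa>\<sigma> + \<gamma>) * \<beta> ^ k"
proof -
  obtain w0 where "w0 \<in> space M" using M.not_empty by blast
  then have \<gamma>: "0 \<le> \<gamma>" using ra_runD(1)[OF run, of w0 k] gam[of w0] by simp
  define r where "r = (\<integral>w. residual w k \<partial>M)"
  define q where "q w = \<theta> * residual w k + a * \<beta> ^ k" for w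
  define Q where "Q = \<theta> * r + a * \<beta> ^ k"
  \<comment> \<open>The bound obtained when the residual is replaced by its mean \<open>r\<close>,
    the sampling error by \<open>Q\<close>, the mean of \<open>q\<close>, and the deviation by
    \<open>Q / \<kappa>\<sigma>\<close>.\<close>
  define B where "B = (\<gamma> * r + \<omega> * Q) + (\<gamma> * Q + (eG + \<kappa>g) * (Q / \<kappa>\<sigma>))"
  have r: "0 \<le> r" unfolding r_def by simp
  have q: "0 \<le> q w" for w unfolding q_def using sampling_params by simp
  have Q: "0 \<le> Q" unfolding Q_def using sampling_params r by simp
  have q_int: "integrable M q" unfolding q_def using int by simp
  have q_E: "(\<integral>w. q w \<partial>M) = Q"
    unfolding q_def Q_def r_def using int by (simp add: M.prob_space)
  have B: "0 \<le> B"
    unfolding B_def using \<gamma> r Q \<omega> eG s grad_bound(1) by simp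
  note [measurable] = measurable_history_imp[OF residual_measurable]
    sample_grad_draws_measurable[of k] measurable_history_imp[OF grad_iterate_measurable[of k]]
  have pair: "(\<lambda>w. (w, xi w k)) \<in> measurable M (hist k \<Otimes>\<^sub>M stream)"
    by (intro measurable_Pair measurable_ident_history draws_measurable)
  have [measurable]: "(\<lambda>w. deviation eG w k (xi w k)) \<in> borel_measurable M"
    using measurable_compose[OF pair deviation_measurable[of eG k, OF dev]] by simp
  have "(\<integral>\<^sup>+w. ennreal (residual w (Suc k)) \<partial>M)
      \<le> (\<integral>\<^sup>+w. ennreal (\<gamma> * residual w k + \<omega> * q w)
          + (ennreal \<gamma> * ennreal (sampling_error w k (xi w k))
             + ennreal (eG + \<kappa>g) * deviation eG w k (xi w k)) \<partial>M)"
  proof (rule nn_integral_mono_AE, use AE_sampling_mse_le[of k] AE_space in eventually_elim)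
    case (elim w)
    show ?case
      unfolding q_def using residual_Suc_le[OF elim(2,1) \<omega> eG gam[OF elim(2)] eps[OF elim(2)]] .
  qed
  also have "\<dots> = (\<integral>\<^sup>+w. ennreal (\<gamma> * residual w k + \<omega> * q w) \<partial>M)
      + (ennreal \<gamma> * (\<integral>\<^sup>+w. ennreal (sampling_error w k (xi w k)) \<partial>M)
         + ennreal (eG + \<kappa>g) * (\<integral>\<^sup>+w. deviation eG w k (xi w k) \<partial>M))"
    using q_int by (simp add: nn_integral_add nn_integral_cmult)
  also have "\<dots> \<le> ennreal (\<gamma> * r + \<omega> * Q)
      + (ennreal \<gamma> * ennreal Q + ennreal (eG + \<kappa>g) * ennreal (Q / \<kappa>\<sigma>))"
  proof (intro add_mono mult_left_mono)
    show "(\<integral>\<^sup>+w. ennreal (\<gamma> * residual w k + \<omega> * q w) \<partial>M) \<le> ennreal (\<gamma> * r + \<omega> * Q)"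
      using int q_int q_E \<gamma> \<omega> q by (subst nn_integral_eq_integral) (auto simp: r_def)
    show "(\<integral>\<^sup>+w. ennreal (sampling_error w k (xi w k)) \<partial>M) \<le> ennreal Q"
      using nn_integral_sampling_error_le[of k] q_int q q_E
      by (simp add: nn_integral_eq_integral flip: q_def)
    show "(\<integral>\<^sup>+w. deviation eG w k (xi w k) \<partial>M) \<le> ennreal (Q / \<kappa>\<sigma>)"
      using nn_integral_deviation_le[OF G s dev sq var] q_int q q_E s
      by (simp add: nn_integral_eq_integral flip: q_def)
  qed auto
  also have "\<dots> = ennreal B"
    unfolding B_def using \<gamma> r Q \<omega> eG s grad_bound(1)
    by (simp add: ennreal_mult'[symmetric] ennreal_plus[symmetric] del: ennreal_plus times_divide_eq_right)
  finally have le: "(\<integral>\<^sup>+w. ennreal (residual w (Suc k)) \<partial>M) \<le> ennreal B" .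
  show "integrable M (\<lambda>w. residual w (Suc k))"
    by (rule nn_integral_le_integrable(1)[OF measurable_history_imp[OF residual_measurable] _ le B]) simp
  have "(\<integral>w. residual w (Suc k) \<partial>M) \<le> B"
    by (rule nn_integral_le_integrable(2)[OF measurable_history_imp[OF residual_measurable] _ le B]) simp
  also have "B = (\<gamma> + \<theta> * (\<omega> + (eG + \<kappa>g) / \<kappa>\<sigma> + \<gamma>)) * r + a * (\<omega> + (eG + \<kappa>g) / \<kappa>\<sigma> + \<gamma>) * \<beta> ^ k"
    unfolding B_def Q_def by (simp add: algebra_simps add_divide_distrib)
  finally show "(\<integral>w. residual w (Suc k) \<partial>M)
      \<le> (\<gamma> + \<theta> * (\<omega> + (eG + \<kappa>g) / \<kappa>\<sigma> + \<gamma>)) * (\<integral>w. residual w k \<partial>M)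
        + a * (\<omega> + (eG + \<kappa>g) / \<kappa>\<sigma> + \<gamma>) * \<beta> ^ k"
    unfolding r_def .
qed

section \<open>Cost bounds along almost every outcome\<close>

lemma grad_var_Suc_le: "w \<in> space M \<Longrightarrow> grad_var P F (x w (Suc k) 0) \<le> \<omega>1\<^sup>2 * \<kappa>g\<^sup>2 + \<omega>2\<^sup>2"
proof -
  assume w: "w \<in> space M"
  have "grad_var P F (x w (Suc k) 0) \<le> \<omega>1\<^sup>2 * (norm (grad f (x w (Suc k) 0)))\<^sup>2 + \<omega>2\<^sup>2"
    by (rule grad_var_le[OF iterate_in[OF w]])
  \<comment> \<open>The point is \<open>x w k (N w k)\<close>, where \<open>\<kappa>g\<close> bounds
    the gradient. The initial point \<open>x0\<close> is not covered, which is why the index is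
    \<open>Suc k\<close>.\<close>
  also have "\<dots> \<le> \<omega>1\<^sup>2 * \<kappa>g\<^sup>2 + \<omega>2\<^sup>2"
    using grad_bound(2)[OF w, of k] ra_runD(3)[OF run[OF w], of k]
    by (intro add_right_mono mult_left_mono power_mono) simp_all
  finally show ?thesis .
qed

lemma complexity:
  assumes eG: "0 < eG" and G: "0 < \<kappa>G" and s: "0 < \<kappa>\<sigma>"
    and dev: "\<And>b. 1 \<le> b \<Longrightarrow> grad_dev X f F eG b \<in> borel_measurable (Pi\<^sub>M {..<b} (\<lambda>i. P))"
    and sq: "\<And>b. 1 \<le> b \<Longrightarrow> (\<integral>\<^sup>+s. (grad_dev X f F eG b s)\<^sup>2 \<partial>(Pi\<^sub>M {..<b} (\<lambda>i. P)))
      \<le> ennreal (\<kappa>G\<^sup>2 / real b)"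
    and var: "\<And>k. AE w in M. \<kappa>G\<^sup>2 * \<kappa>\<sigma>\<^sup>2 \<le> grad_var P F (x w k 0)"
    and \<omega>: "0 < \<omega>" and gam: "\<And>w k. w \<in> space M \<Longrightarrow> gam w k \<le> \<gamma>"
    and eps: "\<And>w k. w \<in> space M \<Longrightarrow>
      eps w k = \<omega> * sqrt (grad_var P F (x w k 0) / real (n w k))"
    and rate: "\<gamma> + \<theta> * (\<omega> + (eG + \<kappa>g) / \<kappa>\<sigma> + \<gamma>) < \<beta>"
    and a: "a = sqrt ((\<omega>1\<^sup>2 * \<kappa>g\<^sup>2 + \<omega>2\<^sup>2) / real n0)"
  shows "\<exists>C>0. \<forall>\<^sub>F e in at_right 0.
    (\<exists>k. accurate_in_expectation M c f x lam N e k) \<and>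
    (let K = (LEAST k. accurate_in_expectation M c f x lam N e k) in
       AE w in M. real (\<Sum>k\<le>K. N w k) \<le> C / e\<^sup>2 \<and>
                  real (\<Sum>k\<le>K. n w k * N w k) \<le> C / e ^ 4)"
proof -
  obtain w0 where w0: "w0 \<in> space M" using M.not_empty by blast
  have \<gamma>: "0 \<le> \<gamma>" using ra_runD(1)[OF run[OF w0], of 0] gam[OF w0, of 0] by linarith
  define v where "v = \<kappa>G\<^sup>2 * \<kappa>\<sigma>\<^sup>2"
  have v: "0 < v" unfolding v_def using G s by simp
  \<comment> \<open>At iteration 1 the variance lies between \<open>v\<close> and this sum almost
    surely, and a constant statement true almost surely is true. It makes \<open>a\<close> positive,
    as the batch size bounds require.\<close>
  have "0 < \<omega>1\<^sup>2 * \<kappa>g\<^sup>2 + \<omega>2\<^sup>2"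
  proof -
    have "AE w in M. 0 < \<omega>1\<^sup>2 * \<kappa>g\<^sup>2 + \<omega>2\<^sup>2"
      using var[of "Suc 0"] AE_space
    proof eventually_elim
      case (elim w)
      then show ?case using grad_var_Suc_le[OF elim(2), of 0] v by (simp add: v_def)
    qed
    then show ?thesis by simp
  qed
  then have a_pos: "0 < a"
    unfolding a using batch_pos[OF w0, of 0] initial(2)[OF w0] by simp

  define \<rho> where "\<rho> = \<gamma> + \<theta> * (\<omega> + (eG + \<kappa>g) / \<kappa>\<sigma> + \<gamma>)"
  define b where "b = a * (\<omega> + (eG + \<kappa>g) / \<kappa>\<sigma> + \<gamma>)"
  define r where "r k = (\<integral>w. residual w k \<partial>M)" for k
  define B where "B = max 1 (max (r 0) (b / (\<beta> - \<rho>)))"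
  have \<rho>: "0 \<le> \<rho>" "\<rho> < \<beta>"
    using \<gamma> \<omega> eG s grad_bound(1) sampling_params rate by (auto simp: \<rho>_def)
  have int: "integrable M (\<lambda>w. residual w k)" for k
  proof (induction k)
    case 0
    have "integrable M (\<lambda>w. residual w 0) \<longleftrightarrow>
        integrable M (\<lambda>w. norm (kkt_res (grad f) c x0 l0))"
      by (rule Bochner_Integration.integrable_cong) (simp_all add: initial prev_dual_def)
    then show ?case by simp
  next
    case (Suc k)
    show ?case by (rule expectation_residual_Suc(1)[OF Suc eG \<omega> G s dev sq var gam eps])
  qed
  have r_Suc: "r (Suc k) \<le> \<rho> * r k + b * \<beta> ^ k" for k
    unfolding r_def \<rho>_def b_def
    by (rule expectation_residual_Suc(2)[OF int eG \<omega> G s dev sq var gam eps])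
  have "b / (\<beta> - \<rho>) \<le> B" by (simp add: B_def)
  then have "b \<le> (\<beta> - \<rho>) * B" using \<rho> by (simp add: field_simps)
  then have r_le: "r k \<le> B * \<beta> ^ k" for k
    using \<rho> r_Suc by (intro linear_recursion_bound[where r = r and \<rho> = \<rho> and b = b])
      (auto simp: B_def)
  have B: "1 \<le> B" by (simp add: B_def)
  have acc: "accurate_in_expectation M c f x lam N e k \<longleftrightarrow> r (Suc k) \<le> e" for e k
  proof -
    have "integrable M (\<lambda>w. residual w (Suc k)) \<longleftrightarrow>
        integrable M (\<lambda>w. norm (kkt_res (grad f) c (x w k (N w k)) (lam w k (N w k))))"
      by (rule Bochner_Integration.integrable_cong[OF refl residual_Suc])
    moreover have "r (Suc k) =
        (\<integral>w. norm (kkt_res (grad f) c (x w k (N w k)) (lam w k (N w k))) \<partial>M)"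
      unfolding r_def by (rule Bochner_Integration.integral_cong[OF refl residual_Suc])
    ultimately show ?thesis
      using int[of "Suc k"] unfolding accurate_in_expectation_def by argo
  qed

  obtain C e0 where C: "0 < C" "0 < e0"
      "\<And>w. w \<in> space M \<Longrightarrow>
        sublinear_inner C e0 c (\<lambda>k. sample_grad F {..<n w k} (xi w k)) (x w) (lam w)"
    using inner_rate by auto
  obtain \<kappa>' where \<kappa>': "\<And>w k b. w \<in> space M \<Longrightarrow> 1 \<le> b \<Longrightarrow>
      grad_var P F (x w k 0) / real b \<le> a\<^sup>2 * \<beta> ^ (2 * k) \<Longrightarrow> real (n w k) \<le> \<kappa>' * real b"
    using batch_economy by blast
  define \<kappa> where "\<kappa> = max 1 \<kappa>'"
  have \<kappa>: "1 \<le> \<kappa>" by (simp add: \<kappa>_def)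
  have econ: "real (n w k) \<le> \<kappa> * real b"
    if "w \<in> space M" "1 \<le> b" "grad_var P F (x w k 0) / real b \<le> a\<^sup>2 * \<beta> ^ (2 * k)" for w k b
    using \<kappa>'[OF that] mult_right_mono[of \<kappa>' \<kappa> "real b"] by (simp add: \<kappa>_def)
  \<comment> \<open>The variance at \<open>x0\<close> enters separately, because the bound through
    \<open>\<kappa>g\<close> starts at iteration 1.\<close>
  define V where "V = max (grad_var P F x0) (\<omega>1\<^sup>2 * \<kappa>g\<^sup>2 + \<omega>2\<^sup>2)"
  have V: "grad_var P F (x w k 0) \<le> V" if "w \<in> space M" for w k
    using grad_var_Suc_le[OF that] initial(1)[OF that] by (cases k) (auto simp: V_def le_max_iff_disj)
  define A where "A = \<kappa> * (V / a\<^sup>2 + 1)"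
  \<comment> \<open>Economical batches give variance over batch size at least
    \<open>\<beta> ^ (2 * k) / z\<close>. Taking roots, \<open>eps w k\<close> is at least
    \<open>t * \<beta> ^ k\<close>.\<close>
  define z where "z = \<kappa> * (1 / a\<^sup>2 + 1 / v)"
  define t where "t = \<omega> / sqrt z"
  have z: "0 < z" unfolding z_def using \<kappa> v a_pos by (simp add: add_pos_pos)
  have t: "0 < t" unfolding t_def using \<omega> z by simp
  define A' where "A' = C / (min e0 t)\<^sup>2"
  have A': "0 < A'" unfolding A'_def using C t by simp
  \<comment> \<open>Countably many null sets are merged, so one exceptional set serves every
    \<open>k\<close> and every accuracy \<open>e\<close>.\<close>
  have "AE w in M. \<forall>k. v \<le> grad_var P F (x w k 0)"
    unfolding v_def using var by (simp add: AE_all_countable)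
  then have bounds: "AE w in M. \<forall>k. real (n w k) \<le> A * (1 / \<beta> ^ (2 * k)) \<and>
      real (N w k) \<le> A' * (1 / \<beta> ^ (2 * k))"
    using AE_space
  proof eventually_elim
    case (elim w)
    show ?case
    proof
      fix k
      have p: "0 < \<beta> ^ (2 * k)" "\<beta> ^ (2 * k) \<le> 1"
        using sampling_params by (auto simp: power_le_one)
      note batch = economical_batch[OF v elim(1)[rule_format] V[OF elim(2)] a_pos p
          batch_pos[OF elim(2)] \<kappa> econ[OF elim(2)]]
      have "(\<beta> ^ k)\<^sup>2 / z \<le> grad_var P F (x w k 0) / real (n w k)"
        using batch(2) by (simp add: z_def power_mult[symmetric] mult.commute[of k])
      then have "sqrt ((\<beta> ^ k)\<^sup>2 / z) \<le> sqrt (grad_var P F (x w k 0) / real (n w k))"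
        by (rule real_sqrt_le_mono)
      moreover have "sqrt ((\<beta> ^ k)\<^sup>2 / z) = \<beta> ^ k / sqrt z"
        using sampling_params by (simp add: real_sqrt_divide)
      ultimately have "\<omega> * (\<beta> ^ k / sqrt z) \<le> eps w k"
        unfolding eps[OF elim(2)] using \<omega> by (metis mult_left_mono less_imp_le)
      then have "t * \<beta> ^ k \<le> eps w k" by (simp add: t_def)
      then have "real (N w k) \<le> A' / \<beta> ^ (2 * k)"
        unfolding A'_def using C t sampling_params
        by (intro ra_run_inner_iterations_geometric[OF run[OF elim(2)] C(3)[OF elim(2)]]) simp_all
      then show "real (n w k) \<le> A * (1 / \<beta> ^ (2 * k)) \<and>
          real (N w k) \<le> A' * (1 / \<beta> ^ (2 * k))"
        using batch(1) by (simp add: A_def)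
    qed
  qed

  have \<beta>q: "\<beta> ^ q < 1" if "0 < q" for q
    using sampling_params that by (simp add: power_less_one_iff)
  have "0 \<le> V" using grad_var_nonneg[of x0] by (simp add: V_def le_max_iff_disj)
  then have A: "0 < A" unfolding A_def using \<kappa> a_pos by (simp add: add_nonneg_pos)
  define C2 where "C2 = A' * (B ^ 2 / (1 - \<beta> ^ 2))"
  \<comment> \<open>Batch size and inner iterations each grow like \<open>\<beta> ^ (2 * k)\<close>
    inverted; their product calls for the geometric cost bound with \<open>q = 4\<close>.\<close>
  define C4 where "C4 = (A * A') * (B ^ 4 / (1 - \<beta> ^ 4))"
  have "0 < C2" unfolding C2_def using A' B \<beta>q[of 2] by simp
  then have C': "0 < max C2 C4" by simp
  show ?thesis
  proof (rule exI[of _ "max C2 C4"], rule conjI[OF C'],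
      rule eventually_mono[OF eventually_at_right_real[of 0 1]])
    fix e :: real
    assume "e \<in> {0<..<1}"
    then have e: "0 < e" "e \<le> 1" by auto
    \<comment> \<open>Accuracy is measured in expectation, so \<open>K\<close> is deterministic and
      the costs of all outcomes are summed up to the same index.\<close>
    define K where "K = (LEAST k. r (Suc k) \<le> e)"
    note cost = geometric_cost_until_accurate[OF sampling_params(3,4) r_le B _ e, folded K_def]
    have "AE w in M. real (\<Sum>k\<le>K. N w k) \<le> max C2 C4 / e\<^sup>2 \<and>
        real (\<Sum>k\<le>K. n w k * N w k) \<le> max C2 C4 / e ^ 4"
      using bounds
    proof eventually_elim
      case (elim w)
      have "real (\<Sum>k\<le>K. N w k) \<le> (\<Sum>k\<le>K. A' * (1 / \<beta> ^ (2 * k)))"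
        using elim by (simp only: of_nat_sum) (intro sum_mono, blast)
      also have "\<dots> \<le> A' * (B ^ 2 / (1 - \<beta> ^ 2) / e ^ 2)"
        using cost(2)[of 2] A' unfolding sum_distrib_left[symmetric] by (intro mult_left_mono) auto
      also have "\<dots> = C2 / e\<^sup>2" by (simp add: C2_def)
      also have "\<dots> \<le> max C2 C4 / e\<^sup>2"
        using e by (intro divide_right_mono) simp_all
      finally have N: "real (\<Sum>k\<le>K. N w k) \<le> max C2 C4 / e\<^sup>2" .
      have "real (n w k * N w k) \<le> (A * A') * (1 / \<beta> ^ (4 * k))" for k
      proof -
        have "real (n w k) * real (N w k) \<le> (A * (1 / \<beta> ^ (2 * k))) * (A' * (1 / \<beta> ^ (2 * k)))"
          using elim A sampling_params by (intro mult_mono) auto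
        also have "\<dots> = (A * A') * (1 / \<beta> ^ (4 * k))"
          by (simp add: power_add[symmetric])
        finally show ?thesis by simp
      qed
      then have "real (\<Sum>k\<le>K. n w k * N w k) \<le> (\<Sum>k\<le>K. (A * A') * (1 / \<beta> ^ (4 * k)))"
        by (simp only: of_nat_sum) (intro sum_mono)
      also have "\<dots> \<le> (A * A') * (B ^ 4 / (1 - \<beta> ^ 4) / e ^ 4)"
        using cost(2)[of 4] A A' unfolding sum_distrib_left[symmetric] by (intro mult_left_mono) auto
      also have "\<dots> = C4 / e ^ 4" by (simp add: C4_def)
      also have "\<dots> \<le> max C2 C4 / e ^ 4"
        using e by (intro divide_right_mono) simp_all
      finally show ?case using N by blast
    qed
    then show "(\<exists>k. accurate_in_expectation M c f x lam N e k) \<and>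
        (let K = (LEAST k. accurate_in_expectation M c f x lam N e k) in
           AE w in M. real (\<Sum>k\<le>K. N w k) \<le> max C2 C4 / e\<^sup>2 \<and>
                      real (\<Sum>k\<le>K. n w k * N w k) \<le> max C2 C4 / e ^ 4)"
      using cost(1)[of 2] unfolding acc Let_def K_def by simp
  qed simp
qed

end

theorem theorem2p8:
  fixes X :: "(real^'n) set" and c :: "real^'n \<Rightarrow> real^'m"
    and F :: "real^'n \<Rightarrow> 's \<Rightarrow> real"
    and D :: "'s set" and S :: "nat \<Rightarrow> 's set"
    and P :: "'s measure" and M :: "'w measure"
  shows
    "(ra_finite_sum X c D F S gam eps l0 x lam N \<theta> \<theta>' a \<beta> \<and>
      0 < \<omega> \<and> 0 < \<omega>' \<and> \<gamma> < 1 \<and>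
      (\<forall>k. 0 \<le> gam k \<and> gam k \<le> \<gamma>) \<and>
      (\<forall>k. eps k = \<omega> * norm (grad (finite_sum_obj D F) (x k 0) - sample_grad F (S k) id (x k 0))
                   + \<omega>' * \<beta> ^ k) \<and>
      \<gamma> + \<theta> * (\<omega> + \<theta>' + \<gamma>) < \<beta>
      \<longrightarrow>
      (\<exists>C>0. \<forall>\<^sub>F e in at_right 0.
         (\<exists>k. accurate c (finite_sum_obj D F) x lam N e k) \<and>
         (let K = (LEAST k. accurate c (finite_sum_obj D F) x lam N e k) in
            real (\<Sum>k\<le>K. N k) \<le> C / e\<^sup>2 \<and>
            real (\<Sum>k\<le>K. card (S k) * N k) \<le> C * (real (card D) / e\<^sup>2))))
     \<and>
     (ra_expectation X c P F M n xi gam' eps' n0 x0 l0' x' lam' N' \<theta>t a' \<beta>t \<omega>1 \<omega>2 \<kappa>g \<and>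
      0 < \<epsilon>G \<and> 0 < \<kappa>G \<and> 0 < \<kappa>\<sigma> \<and>
      (\<forall>b\<ge>1. grad_dev X (expectation_obj P F) F \<epsilon>G b \<in> borel_measurable (Pi\<^sub>M {..<b} (\<lambda>i. P)) \<and>
         (\<integral>\<^sup>+s. (grad_dev X (expectation_obj P F) F \<epsilon>G b s)\<^sup>2 \<partial>(Pi\<^sub>M {..<b} (\<lambda>i. P)))
           \<le> ennreal (\<kappa>G\<^sup>2 / real b)) \<and>
      (\<forall>k. AE w in M. \<kappa>G\<^sup>2 * \<kappa>\<sigma>\<^sup>2 \<le> grad_var P F (x' w k 0)) \<and>
      0 < \<omega>t \<and> \<gamma>t < 1 \<and>
      (\<forall>w\<in>space M. \<forall>k. 0 \<le> gam' w k \<and> gam' w k \<le> \<gamma>t) \<and>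
      (\<forall>w\<in>space M. \<forall>k. eps' w k = \<omega>t * sqrt (grad_var P F (x' w k 0) / real (n w k))) \<and>
      \<gamma>t + \<theta>t * (\<omega>t + (\<epsilon>G + \<kappa>g) / \<kappa>\<sigma> + \<gamma>t) < \<beta>t \<and>
      a' = sqrt ((\<omega>1\<^sup>2 * \<kappa>g\<^sup>2 + \<omega>2\<^sup>2) / real n0)
      \<longrightarrow>
      (\<exists>C>0. \<forall>\<^sub>F e in at_right 0.
         (\<exists>k. accurate_in_expectation M c (expectation_obj P F) x' lam' N' e k) \<and>
         (let K = (LEAST k. accurate_in_expectation M c (expectation_obj P F) x' lam' N' e k) in
            AE w in M. real (\<Sum>k\<le>K. N' w k) \<le> C / e\<^sup>2 \<and>
                       real (\<Sum>k\<le>K. n w k * N' w k) \<le> C / e ^ 4)))"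
proof (intro conjI impI)
  assume H: "ra_finite_sum X c D F S gam eps l0 x lam N \<theta> \<theta>' a \<beta> \<and>
      0 < \<omega> \<and> 0 < \<omega>' \<and> \<gamma> < 1 \<and>
      (\<forall>k. 0 \<le> gam k \<and> gam k \<le> \<gamma>) \<and>
      (\<forall>k. eps k = \<omega> * norm (grad (finite_sum_obj D F) (x k 0) - sample_grad F (S k) id (x k 0))
                   + \<omega>' * \<beta> ^ k) \<and>
      \<gamma> + \<theta> * (\<omega> + \<theta>' + \<gamma>) < \<beta>"
  then interpret ra_finite_sum X c D F S gam eps l0 x lam N \<theta> \<theta>' a \<beta> by blast
  show "\<exists>C>0. \<forall>\<^sub>F e in at_right 0.
      (\<exists>k. accurate c (finite_sum_obj D F) x lam N e k) \<and>
      (let K = (LEAST k. accurate c (finite_sum_obj D F) x lam N e k) in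
         real (\<Sum>k\<le>K. N k) \<le> C / e\<^sup>2 \<and>
         real (\<Sum>k\<le>K. card (S k) * N k) \<le> C * (real (card D) / e\<^sup>2))"
    by (rule complexity[where \<omega> = \<omega> and \<omega>' = \<omega>' and \<gamma> = \<gamma>]) (use H in blast)+
next
  assume H: "ra_expectation X c P F M n xi gam' eps' n0 x0 l0' x' lam' N' \<theta>t a' \<beta>t \<omega>1 \<omega>2 \<kappa>g \<and>
      0 < \<epsilon>G \<and> 0 < \<kappa>G \<and> 0 < \<kappa>\<sigma> \<and>
      (\<forall>b\<ge>1. grad_dev X (expectation_obj P F) F \<epsilon>G b \<in> borel_measurable (Pi\<^sub>M {..<b} (\<lambda>i. P)) \<and>
         (\<integral>\<^sup>+s. (grad_dev X (expectation_obj P F) F \<epsilon>G b s)\<^sup>2 \<partial>(Pi\<^sub>M {..<b} (\<lambda>i. P)))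
           \<le> ennreal (\<kappa>G\<^sup>2 / real b)) \<and>
      (\<forall>k. AE w in M. \<kappa>G\<^sup>2 * \<kappa>\<sigma>\<^sup>2 \<le> grad_var P F (x' w k 0)) \<and>
      0 < \<omega>t \<and> \<gamma>t < 1 \<and>
      (\<forall>w\<in>space M. \<forall>k. 0 \<le> gam' w k \<and> gam' w k \<le> \<gamma>t) \<and>
      (\<forall>w\<in>space M. \<forall>k. eps' w k = \<omega>t * sqrt (grad_var P F (x' w k 0) / real (n w k))) \<and>
      \<gamma>t + \<theta>t * (\<omega>t + (\<epsilon>G + \<kappa>g) / \<kappa>\<sigma> + \<gamma>t) < \<beta>t \<and>
      a' = sqrt ((\<omega>1\<^sup>2 * \<kappa>g\<^sup>2 + \<omega>2\<^sup>2) / real n0)"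
  then interpret ra_expectation X c P F M n xi gam' eps' n0 x0 l0' x' lam' N' \<theta>t a' \<beta>t \<omega>1 \<omega>2 \<kappa>g
    by blast
  show "\<exists>C>0. \<forall>\<^sub>F e in at_right 0.
      (\<exists>k. accurate_in_expectation M c (expectation_obj P F) x' lam' N' e k) \<and>
      (let K = (LEAST k. accurate_in_expectation M c (expectation_obj P F) x' lam' N' e k) in
         AE w in M. real (\<Sum>k\<le>K. N' w k) \<le> C / e\<^sup>2 \<and>
                    real (\<Sum>k\<le>K. n w k * N' w k) \<le> C / e ^ 4)"
    by (rule complexity[where eG = \<epsilon>G and \<kappa>G = \<kappa>G and \<kappa>\<sigma> = \<kappa>\<sigma> and \<omega> = \<omega>t and \<gamma> = \<gamma>t])
      (use H in blast)+
qed

end
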